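(* Suppose $3\le d=O_b(1)$, $d_{\mathrm{in}}=d-1$, $d_{\mathrm{out}}=1$ and $p=\lfloor b^\alpha\rfloor$ where $\alpha\in(0,\frac14]$ is a constant independent of $b$. Then there exists a constant $\delta>0$ such that, with probability $1-o(1)$ over the choice of $B\sim\mathcal{G}(b,p,d_{\mathrm{in}},d_{\mathrm{out}})$, the following holds for every configuration $\tau$ on $\partial P$: $$\mu_{\mathbb{B}}\Big(\bigcup_{i\in[q]}\{\sigma^i(B)\}\ \Big|\ \partial P=\tau\Big)\ge\Big(1-\frac{q^2e^{2h}}{e^{\delta\beta_Bd}}\Big)^{2b}.$$
   Context: Random graph $\mathcal{G}(b,p,d_{\mathrm{in}},d_{\mathrm{out}})$ (integers $b\ge p$, $d=d_{\mathrm{in}}+d_{\mathrm{out}}\ge3$): take vertex set $V_B=L\cup R$ with $|L|=|R|=b$ disjoint; choose a uniformly random set of ports $P\subseteq V_B$ with $|P\cap L|=|P\cap R|=p$; take $d_{\mathrm{in}}$ independent uniformly random perfect matchings between $L$ and $R$ and $d_{\mathrm{out}}$ independent uniformly random perfect matchings between $L\setminus P$ and $R\setminus P$; $E_B$ is the union of these matchings with multiple edges replaced by single edges. Let $B=(V_B,E_B)$ be an induced subgraph of a larger graph $\mathbb{B}=(V_{\mathbb{B}},E_{\mathbb{B}})$, with $\partial P=V_{\mathbb{B}}\setminus V_B$, where each port is adjacent to at most $d_{\mathrm{out}}$ vertices of $\partial P$ and no vertex of $V_B\setminus P$ is adjacent to $\partial P$. Consider the $q$-state Potts model on $\mathbb{B}$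 (Gibbs distribution $\mu_{\mathbb{B}}(\sigma)\propto\exp(\sum_{\{u,v\}\in E_{\mathbb{B}}}\beta_{\mathbb{B}}(\{u,v\})\mathbb{1}(\sigma(u)=\sigma(v))+\sum_vh_{\mathbb{B}}(v,\sigma(v)))$) where $\beta_{\mathbb{B}}(e)=\beta_B>0$ for $e\in E_B$, $|\beta_{\mathbb{B}}(e)|\le\beta_B$ for $e\in E_{\mathbb{B}}\setminus E_B$, and $h_{\mathbb{B}}(v,i)=h\cdot\mathbb{1}(i=\kappa)\mathbb{1}(v\in V_B)$ for some $\kappa\in[q]$, $h\in\mathbb{R}$. $\sigma^i(B)$ is the configuration of $V_B$ with all vertices assigned spin $i$, and $\{\partial P=\tau\}$ is the event that the configuration on $\partial P$ equals $\tau\in[q]^{\partial P}$. $o(1)$ is as $b\to\infty$.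
   Formalization: The bound is proved with e^{2|h|} in place of e^{2h} and with the base replaced by its maximum with 0, since the literal bound fails for h→−∞ (q≥3) and when the base is below −1 (its even power then exceeds 1). *)

theory Defs
  imports "HOL-Probability.Probability" "HOL-Library.Landau_Symbols"
begin

definition perfect_matchings :: "'v set \<Rightarrow> 'v set \<Rightarrow> 'v set set set" where
  "perfect_matchings A B =
     {M. M \<subseteq> {{u, v} | u v. u \<in> A \<and> v \<in> B} \<and> (\<forall>x\<in>A \<union> B. \<exists>!e. e \<in> M \<and> x \<in> e)}"

definition port_sets :: "'v set \<Rightarrow> 'v set \<Rightarrow> nat \<Rightarrow> 'v set set" where
  "port_sets L R p = {P. P \<subseteq> L \<union> R \<and> card (P \<inter> L) = p \<and> card (P \<inter> R) = p}"

text \<open>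
  The joint law of the port set and the edge set of the random graph; the vertex set
  \<open>L \<union> R\<close> is deterministic. As edges form a set, parallel edges are identified.
\<close>

definition random_port_graph ::
  "'v set \<Rightarrow> 'v set \<Rightarrow> nat \<Rightarrow> nat \<Rightarrow> nat \<Rightarrow> ('v set \<times> 'v set set) pmf" where
  "random_port_graph L R p d_in d_out =
     bind_pmf (pmf_of_set (port_sets L R p)) (\<lambda>P.
     bind_pmf (replicate_pmf d_in (pmf_of_set (perfect_matchings L R))) (\<lambda>Ms.
     bind_pmf (replicate_pmf d_out (pmf_of_set (perfect_matchings (L - P) (R - P)))) (\<lambda>Ns.
     return_pmf (P, \<Union>(set Ms) \<union> \<Union>(set Ns)))))"

definition simple_graph :: "'v set \<Rightarrow> 'v set set \<Rightarrow> bool" where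
  "simple_graph V E \<longleftrightarrow> finite V \<and> (\<forall>e\<in>E. e \<subseteq> V \<and> card e = 2)"

definition port_extension ::
  "'v set \<Rightarrow> 'v set set \<Rightarrow> 'v set \<Rightarrow> nat \<Rightarrow> 'v set \<Rightarrow> 'v set set \<Rightarrow> bool" where
  "port_extension V\<^sub>B E\<^sub>B P d_out V E \<longleftrightarrow>
     simple_graph V E \<and> V\<^sub>B \<subseteq> V \<and> {e \<in> E. e \<subseteq> V\<^sub>B} = E\<^sub>B \<and>
     (\<forall>u\<in>P. card {w \<in> V - V\<^sub>B. {u, w} \<in> E} \<le> d_out) \<and>
     (\<forall>u\<in>V\<^sub>B - P. \<forall>w\<in>V - V\<^sub>B. {u, w} \<notin> E)"

definition configs :: "'v set \<Rightarrow> nat \<Rightarrow> ('v \<Rightarrow> nat) set" where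
  "configs V q = V \<rightarrow>\<^sub>E {1..q}"

definition potts_weight ::
  "'v set \<Rightarrow> 'v set set \<Rightarrow> ('v set \<Rightarrow> real) \<Rightarrow> ('v \<Rightarrow> nat \<Rightarrow> real) \<Rightarrow> ('v \<Rightarrow> nat) \<Rightarrow> real" where
  "potts_weight V E \<beta> h \<sigma> =
     exp ((\<Sum>e\<in>E. \<beta> e * of_bool (\<forall>u\<in>e. \<forall>v\<in>e. \<sigma> u = \<sigma> v)) + (\<Sum>v\<in>V. h v (\<sigma> v)))"

definition potts_partition ::
  "'v set \<Rightarrow> 'v set set \<Rightarrow> ('v set \<Rightarrow> real) \<Rightarrow> ('v \<Rightarrow> nat \<Rightarrow> real) \<Rightarrow> nat \<Rightarrow> real" where
  "potts_partition V E \<beta> h q = (\<Sum>\<sigma>\<in>configs V q. potts_weight V E \<beta> h \<sigma>)"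

definition potts_pmf ::
  "'v set \<Rightarrow> 'v set set \<Rightarrow> ('v set \<Rightarrow> real) \<Rightarrow> ('v \<Rightarrow> nat \<Rightarrow> real) \<Rightarrow> nat \<Rightarrow> ('v \<Rightarrow> nat) pmf" where
  "potts_pmf V E \<beta> h q =
     embed_pmf (\<lambda>\<sigma>. if \<sigma> \<in> configs V q
                     then potts_weight V E \<beta> h \<sigma> / potts_partition V E \<beta> h q else 0)"

lemma finite_configs: "finite V \<Longrightarrow> finite (configs V q)"
  unfolding configs_def by (rule finite_PiE) auto

lemma configs_nonempty: "q \<ge> 1 \<Longrightarrow> configs V q \<noteq> {}"
  unfolding configs_def by (auto simp: PiE_eq_empty_iff)

lemma potts_partition_pos:
  assumes "finite V" "q \<ge> 1"
  shows "potts_partition V E \<beta> h q > 0"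
  unfolding potts_partition_def
  by (rule sum_pos) (use assms finite_configs configs_nonempty in \<open>auto simp: potts_weight_def\<close>)

lemma pmf_potts_pmf:
  assumes "finite V" "q \<ge> 1"
  shows "pmf (potts_pmf V E \<beta> h q) \<sigma> =
    (if \<sigma> \<in> configs V q then potts_weight V E \<beta> h \<sigma> / potts_partition V E \<beta> h q else 0)"
proof -
  let ?C = "configs V q" and ?w = "potts_weight V E \<beta> h" and ?Z = "potts_partition V E \<beta> h q"
  let ?f = "\<lambda>\<sigma>. if \<sigma> \<in> ?C then ?w \<sigma> / ?Z else 0"
  have Z: "?Z > 0" using assms by (rule potts_partition_pos)
  have nn: "0 \<le> ?f \<sigma>" for \<sigma> using Z by (auto simp: potts_weight_def)
  have "(\<integral>\<^sup>+\<sigma>. ennreal (?f \<sigma>) \<partial>count_space UNIV) = (\<Sum>\<sigma>\<in>?C. ennreal (?f \<sigma>))"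
    by (rule nn_integral_count_space') (use assms finite_configs in auto)
  also have "\<dots> = ennreal (\<Sum>\<sigma>\<in>?C. ?f \<sigma>)" using nn by (rule sum_ennreal)
  also have "(\<Sum>\<sigma>\<in>?C. ?f \<sigma>) = (\<Sum>\<sigma>\<in>?C. ?w \<sigma>) / ?Z" by (simp add: sum_divide_distrib)
  also have "\<dots> = 1" using Z by (simp add: potts_partition_def)
  finally have "(\<integral>\<^sup>+\<sigma>. ennreal (?f \<sigma>) \<partial>count_space UNIV) = 1" by simp
  then show ?thesis unfolding potts_pmf_def using nn by (subst pmf_embed_pmf) auto
qed

end

theory Submission
  imports Defs "HOL-Real_Asymp.Real_Asymp"
begin

text \<open>
  Three of the random matchings already form a graph in which every vertex set \<open>S\<close> with at most
  \<open>b\<close> vertices has at least \<open>|S \<inter> P| + c |S|\<close> boundary edges, for an absolute constant \<open>c > 0\<close>.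
  For small \<open>S\<close> a first moment bound, weighting a port by \<open>b\<^bsup>1/4\<^esup>\<close> instead of \<open>b\<close>, shows that \<open>S\<close> spans fewer
  than \<open>|S - P| + |S \<inter> P| / 4 + |S| / 8\<close> edges; comparing this for \<open>S\<close> and for \<open>S\<close> together with
  its neighbours gives the expansion. For \<open>S\<close> of linear size the ports are negligible and a union
  bound shows that some matching has linearly many edges leaving \<open>S\<close>.

  Given such expansion, every configuration \<open>\<sigma>\<close> has a colour \<open>i\<close> such that recolouring all of \<open>V\<^sub>B\<close>
  with \<open>i\<close> gains a factor exponential in the number of vertices that change colour, uniformly in the
  boundary condition. Summing over all \<open>\<sigma>\<close> gives \<open>(1 + (q - 1) y) ^ (2 b)\<close> times the weight of the
  monochromatic configurations, with \<open>y = exp (|h| - c \<beta>\<^sub>B / 4)\<close>. As \<open>d\<close> is bounded, \<open>\<delta>\<close> only has to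
  be small compared with \<open>c / d\<close>.
\<close>

section \<open>Perfect matchings\<close>

text \<open>The term \<open>card (S \<inter> P)\<close> in the expansion is the price of the
  boundary: a port has at most one edge leaving the block, of strength at most
  \<open>\<beta>\<^sub>B\<close> in absolute value, so recolouring the port may lose
  \<open>\<beta>\<^sub>B\<close> there, and one extra boundary edge inside must repay it. Sets of
  ports are the obstacle. In the three matchings a port has degree 2 only, so a path of ports would
  have just two boundary edges. It is excluded because there are at most b^(1/4) ports per side: a
  small set of k ports spans fewer than 3k/8 edges and so keeps more than 2k - 3k/4 = 5k/4 boundary
  edges, counted with multiplicity. For sets of linear size the third matching is decisive: the
  number of candidate sets uses up what two matchings gain. All randomness is confined to
  \<open>port_expander\<close>. What is derived from it is deterministic, hence uniform in the
  surrounding graph, the couplings, the field and the boundary condition.\<close>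

definition inner_edges :: "'v set set \<Rightarrow> 'v set \<Rightarrow> 'v set set" where
  "inner_edges E S = {e \<in> E. e \<subseteq> S}"

definition cut_edges :: "'v set set \<Rightarrow> 'v set \<Rightarrow> 'v set set" where
  "cut_edges E S = {e \<in> E. e \<inter> S \<noteq> {} \<and> \<not> e \<subseteq> S}"

text \<open>In all uses \<open>card W = 2 * b\<close>, so this is edge expansion for sets of at most
  half the vertices, strengthened by one further edge for every port.\<close>

definition port_expander :: "'v set \<Rightarrow> 'v set set \<Rightarrow> 'v set \<Rightarrow> nat \<Rightarrow> real \<Rightarrow> bool" where
  "port_expander W E P b c \<longleftrightarrow> (\<forall>S\<subseteq>W. card S \<le> b \<longrightarrow>
     real (card (S \<inter> P)) + c * real (card S) \<le> real (card (cut_edges E S)))"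

lemma perfect_matchings_edge:
  assumes "M \<in> perfect_matchings A B" "e \<in> M"
  obtains u v where "u \<in> A" "v \<in> B" "e = {u, v}"
  using assms unfolding perfect_matchings_def by blast

lemma perfect_matchings_unique:
  assumes "M \<in> perfect_matchings A B" "e \<in> M" "f \<in> M" "x \<in> e" "x \<in> f"
  shows "e = f"
proof -
  have "x \<in> A \<union> B" using assms by (auto elim: perfect_matchings_edge)
  then have "\<exists>!g. g \<in> M \<and> x \<in> g" using assms(1) unfolding perfect_matchings_def by blast
  then show ?thesis using assms by blast
qed

lemma perfect_matchings_cover:
  assumes "M \<in> perfect_matchings A B" "x \<in> A \<union> B"
  obtains e where "e \<in> M" "x \<in> e"
  using assms unfolding perfect_matchings_def by blast

lemma perfect_matchings_Union: "M \<in> perfect_matchings A B \<Longrightarrow> \<Union>M = A \<union> B"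
  by (auto elim: perfect_matchings_edge perfect_matchings_cover)

lemma finite_perfect_matching:
  assumes "M \<in> perfect_matchings A B" "finite A" "finite B"
  shows "finite M"
proof (rule finite_subset)
  show "M \<subseteq> Pow (A \<union> B)" using perfect_matchings_Union[OF assms(1)] by auto
qed (use assms in auto)

lemma finite_perfect_matchings:
  assumes "finite A" "finite B"
  shows "finite (perfect_matchings A B)"
proof (rule finite_subset)
  show "perfect_matchings A B \<subseteq> Pow (Pow (A \<union> B))"
    using perfect_matchings_Union by fastforce
qed (use assms in auto)

lemma perfect_matchingsI:
  assumes "\<And>e. e \<in> M \<Longrightarrow> \<exists>u\<in>A. \<exists>v\<in>B. e = {u, v}"
    and "\<And>x. x \<in> A \<union> B \<Longrightarrow> \<exists>e\<in>M. x \<in> e"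
    and "\<And>x e f. e \<in> M \<Longrightarrow> f \<in> M \<Longrightarrow> x \<in> e \<Longrightarrow> x \<in> f \<Longrightarrow> e = f"
  shows "M \<in> perfect_matchings A B"
  unfolding perfect_matchings_def
proof (intro CollectI conjI ballI)
  show "M \<subseteq> {{u, v} |u v. u \<in> A \<and> v \<in> B}" using assms(1) by blast
  fix x assume "x \<in> A \<union> B"
  then show "\<exists>!e. e \<in> M \<and> x \<in> e" using assms(2,3) by blast
qed

lemma perfect_matchings_empty: "perfect_matchings {} {} = {{}}"
  unfolding perfect_matchings_def by auto

text \<open>Deleting the edge at \<open>a\<close> leaves a perfect matching that misses the partner
  \<open>v\<close>; this recursion gives the factorial count below.\<close>

lemma perfect_matchings_insert:
  assumes a: "a \<notin> A" "a \<notin> B" and disj: "A \<inter> B = {}"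
  shows "perfect_matchings (insert a A) B =
    (\<Union>v\<in>B. insert {a, v} ` perfect_matchings A (B - {v}))" (is "?L = ?R")
proof (intro equalityI subsetI)
  fix M assume M: "M \<in> ?L"
  obtain e where e: "e \<in> M" "a \<in> e" using perfect_matchings_cover[OF M] by blast
  obtain v where v: "v \<in> B" "e = {a, v}"
    using perfect_matchings_edge[OF M e(1)] e(2) a(2) by (metis insertE singletonD)
  have "M - {e} \<in> perfect_matchings A (B - {v})"
  proof (rule perfect_matchingsI)
    fix f assume f: "f \<in> M - {e}"
    then obtain u w where uw: "u \<in> insert a A" "w \<in> B" "f = {u, w}"
      using perfect_matchings_edge[OF M] by blast
    have "a \<notin> f" "v \<notin> f" using perfect_matchings_unique[OF M e(1)] f e v by blast+
    then show "\<exists>u\<in>A. \<exists>w\<in>B - {v}. f = {u, w}" using uw by blast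
  next
    fix x assume x: "x \<in> A \<union> (B - {v})"
    then obtain f where f: "f \<in> M" "x \<in> f" using perfect_matchings_cover[OF M] by blast
    have "x \<noteq> a" "x \<noteq> v" using x a v disj by auto
    then show "\<exists>f\<in>M - {e}. x \<in> f" using f v by blast
  qed (use perfect_matchings_unique[OF M] in blast)
  then show "M \<in> ?R" using v e by (auto intro!: bexI[of _ v] image_eqI[of _ _ "M - {e}"])
next
  fix M assume "M \<in> ?R"
  then obtain v K where v: "v \<in> B" and K: "K \<in> perfect_matchings A (B - {v})"
    and M: "M = insert {a, v} K" by blast
  have UK: "\<Union>K = A \<union> (B - {v})" using K by (rule perfect_matchings_Union)
  have av: "a \<notin> f" "v \<notin> f" if "f \<in> K" for f using UK that a v disj by auto
  show "M \<in> ?L"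
  proof (rule perfect_matchingsI)
    fix e assume "e \<in> M"
    then show "\<exists>u\<in>insert a A. \<exists>v\<in>B. e = {u, v}"
      unfolding M using v perfect_matchings_edge[OF K] by (metis Diff_iff insert_iff)
  next
    fix x assume "x \<in> insert a A \<union> B"
    then show "\<exists>e\<in>M. x \<in> e" using UK unfolding M by blast
  next
    fix x e f assume "e \<in> M" "f \<in> M" "x \<in> e" "x \<in> f"
    then show "e = f" unfolding M using perfect_matchings_unique[OF K] av by blast
  qed
qed

lemma card_perfect_matchings:
  assumes "finite A" "finite B" "card A = card B" "A \<inter> B = {}"
  shows "card (perfect_matchings A B) = fact (card A)"
  using assms
proof (induction A arbitrary: B rule: finite_induct)
  case empty
  then have "B = {}" by simp
  then show ?case by (simp add: perfect_matchings_empty)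
next
  case (insert a A)
  have ab: "a \<notin> B" "A \<inter> B = {}" using insert.prems by auto
  have nin: "{a, v} \<notin> K" if "K \<in> perfect_matchings A (B - {w})" for v w K
    using perfect_matchings_Union[OF that] insert.hyps ab by auto
  have "card (perfect_matchings (insert a A) B) =
    (\<Sum>v\<in>B. card (insert {a, v} ` perfect_matchings A (B - {v})))"
    unfolding perfect_matchings_insert[OF insert.hyps(2) ab]
  proof (rule card_UN_disjoint)
    show "\<forall>v\<in>B. finite (insert {a, v} ` perfect_matchings A (B - {v}))"
      using insert.hyps insert.prems by (simp add: finite_perfect_matchings)
    show "\<forall>v\<in>B. \<forall>w\<in>B. v \<noteq> w \<longrightarrow> insert {a, v} ` perfect_matchings A (B - {v}) \<inter>
        insert {a, w} ` perfect_matchings A (B - {w}) = {}"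
    proof (intro ballI impI equals0I)
      fix v w M assume vw: "v \<in> B" "w \<in> B" "v \<noteq> w"
        and M: "M \<in> insert {a, v} ` perfect_matchings A (B - {v}) \<inter>
          insert {a, w} ` perfect_matchings A (B - {w})"
      from M have "M \<in> insert {a, v} ` perfect_matchings A (B - {v})" by (rule IntD1)
      then obtain K where K: "K \<in> perfect_matchings A (B - {v})" "M = insert {a, v} K" by auto
      from M have "M \<in> insert {a, w} ` perfect_matchings A (B - {w})" by (rule IntD2)
      then have "{a, w} \<in> M" by blast
      then have "{a, w} = {a, v}" using nin[OF K(1)] unfolding K(2) by blast
      then show False using vw ab by (auto simp: doubleton_eq_iff)
    qed
  qed (use insert in auto)
  also have "\<dots> = (\<Sum>v\<in>B. fact (card A))"
  proof (rule sum.cong[OF refl])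
    fix v assume v: "v \<in> B"
    have "inj_on (insert {a, v}) (perfect_matchings A (B - {v}))"
      using nin by (intro inj_onI) (metis insert_ident)
    moreover have "card (perfect_matchings A (B - {v})) = fact (card A)"
      using insert v by (intro insert.IH) auto
    ultimately show "card (insert {a, v} ` perfect_matchings A (B - {v})) = fact (card A)"
      by (simp add: card_image)
  qed
  also have "\<dots> = fact (card (insert a A))"
    using insert by (simp flip: insert.prems(2))
  finally show ?case .
qed

lemma card_Int_perfect_matching:
  assumes M: "M \<in> perfect_matchings A B" and fin: "finite A" "finite B"
  shows "card (S \<inter> (A \<union> B)) = (\<Sum>e\<in>M. card (e \<inter> S))"
proof -
  have fe: "finite e" if "e \<in> M" for e using perfect_matchings_edge[OF M that] by auto
  have "S \<inter> (A \<union> B) = (\<Union>e\<in>M. e \<inter> S)" unfolding perfect_matchings_Union[OF M, symmetric] by auto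
  also have "card \<dots> = (\<Sum>e\<in>M. card (e \<inter> S))"
    using finite_perfect_matching[OF M fin] fe perfect_matchings_unique[OF M]
    by (intro card_UN_disjoint) blast+
  finally show ?thesis .
qed

lemma card_perfect_matching:
  assumes M: "M \<in> perfect_matchings A B" and fin: "finite A" "finite B" and disj: "A \<inter> B = {}"
  shows "card A = card M" "card B = card M"
proof -
  have "card (e \<inter> A) = 1 \<and> card (e \<inter> B) = 1" if e: "e \<in> M" for e
  proof -
    obtain u v where "u \<in> A" "v \<in> B" "e = {u, v}" using perfect_matchings_edge[OF M e] .
    then have "e \<inter> A = {u}" "e \<inter> B = {v}" using disj by auto
    then show ?thesis by simp
  qed
  then show "card A = card M" "card B = card M"
    using card_Int_perfect_matching[OF M fin, of A] card_Int_perfect_matching[OF M fin, of B]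
    by (simp_all add: Int_absorb2)
qed

text \<open>A degree sum: a cut edge accounts for one covered vertex of \<open>S\<close>, an inner
  edge for two. \<open>S\<close> may contain uncovered vertices, as it will when ports meet the
  matching of the non-ports.\<close>

lemma card_perfect_matching_edges:
  assumes M: "M \<in> perfect_matchings A B" and fin: "finite A" "finite B" and disj: "A \<inter> B = {}"
  shows "card (S \<inter> (A \<union> B)) = card (cut_edges M S) + 2 * card (inner_edges M S)"
proof -
  have fM: "finite M" using finite_perfect_matching[OF M fin] .
  have "card (e \<inter> S) = of_bool (e \<in> cut_edges M S) + 2 * of_bool (e \<in> inner_edges M S)"
    if e: "e \<in> M" for e
  proof -
    obtain u v where uv: "u \<in> A" "v \<in> B" "e = {u, v}" using perfect_matchings_edge[OF M e] .
    moreover have "u \<noteq> v" using uv disj by auto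
    moreover have "e \<inter> S = (if u \<in> S then {u} else {}) \<union> (if v \<in> S then {v} else {})"
      using uv by auto
    ultimately show ?thesis using e unfolding cut_edges_def inner_edges_def by auto
  qed
  then have "(\<Sum>e\<in>M. card (e \<inter> S)) =
      (\<Sum>e\<in>M. of_bool (e \<in> cut_edges M S)) + 2 * (\<Sum>e\<in>M. of_bool (e \<in> inner_edges M S))"
    by (simp add: sum.distrib sum_distrib_left)
  also have "(\<Sum>e\<in>M. of_bool (e \<in> cut_edges M S)) = card (M \<inter> cut_edges M S)"
    using fM by (simp add: Int_def)
  also have "(\<Sum>e\<in>M. of_bool (e \<in> inner_edges M S)) = card (M \<inter> inner_edges M S)"
    using fM by (simp add: Int_def)
  also have "M \<inter> cut_edges M S = cut_edges M S" unfolding cut_edges_def by auto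
  also have "M \<inter> inner_edges M S = inner_edges M S" unfolding inner_edges_def by auto
  finally show ?thesis using card_Int_perfect_matching[OF M fin] by simp
qed

text \<open>Such a matching splits into a matching of \<open>T\<close> with \<open>U\<close> and one
  of the remaining vertices, and the two pieces determine it.\<close>

lemma card_perfect_matchings_restricted:
  assumes fin: "finite L" "finite R" and eq: "card L = card R" and disj: "L \<inter> R = {}"
    and TU: "T \<subseteq> L" "U \<subseteq> R" "card T = t" "card U = t"
  shows "card {M \<in> perfect_matchings L R. inner_edges M (T \<union> U) \<in> perfect_matchings T U}
    \<le> fact t * fact (card L - t)" (is "card ?X \<le> _")
proof -
  let ?g = "\<lambda>M. (inner_edges M (T \<union> U), M - inner_edges M (T \<union> U))"
  have fTU: "finite T" "finite U" using TU fin finite_subset by blast+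
  have "inj_on ?g ?X"
    by (intro inj_onI) (auto simp: inner_edges_def)
  moreover have "?g ` ?X \<subseteq> perfect_matchings T U \<times> perfect_matchings (L - T) (R - U)"
  proof (intro image_subsetI SigmaI)
    fix M assume M: "M \<in> ?X"
    then have M_LR: "M \<in> perfect_matchings L R" and M_TU: "inner_edges M (T \<union> U) \<in> perfect_matchings T U"
      by auto
    show "inner_edges M (T \<union> U) \<in> perfect_matchings T U" by (rule M_TU)
    show "M - inner_edges M (T \<union> U) \<in> perfect_matchings (L - T) (R - U)"
    proof (rule perfect_matchingsI)
      fix e assume e: "e \<in> M - inner_edges M (T \<union> U)"
      then obtain u v where uv: "u \<in> L" "v \<in> R" "e = {u, v}" using perfect_matchings_edge[OF M_LR] by blast
      have "x \<notin> e" if x: "x \<in> T \<union> U" for x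
      proof
        assume xe: "x \<in> e"
        obtain f where f: "f \<in> inner_edges M (T \<union> U)" "x \<in> f" using perfect_matchings_cover[OF M_TU x] .
        then have "f \<in> M" by (auto simp: inner_edges_def)
        then have "e = f" using perfect_matchings_unique[OF M_LR] f xe e by blast
        then show False using f e by blast
      qed
      then show "\<exists>u\<in>L - T. \<exists>v\<in>R - U. e = {u, v}" using uv by blast
    next
      fix x assume x: "x \<in> (L - T) \<union> (R - U)"
      then obtain e where e: "e \<in> M" "x \<in> e" using perfect_matchings_cover[OF M_LR] by blast
      have "x \<notin> T \<union> U" using x disj TU by blast
      then show "\<exists>e\<in>M - inner_edges M (T \<union> U). x \<in> e" using e unfolding inner_edges_def by blast
    qed (use perfect_matchings_unique[OF M_LR] in blast)
  qed
  ultimately have "card ?X \<le> card (perfect_matchings T U \<times> perfect_matchings (L - T) (R - U))"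
    using fin fTU by (intro card_inj_on_le) (auto intro!: finite_perfect_matchings)
  also have "\<dots> = fact t * fact (card L - t)"
  proof -
    have "card (perfect_matchings T U) = fact t"
      using card_perfect_matchings[OF fTU] TU disj by auto
    moreover have "card (perfect_matchings (L - T) (R - U)) = fact (card (L - T))"
      using TU fin disj fTU eq by (intro card_perfect_matchings) (auto simp: card_Diff_subset)
    ultimately show ?thesis using TU fTU by (simp add: card_cartesian_product card_Diff_subset)
  qed
  finally show ?thesis .
qed

text \<open>Any \<open>t\<close> of the inner edges serve, with \<open>T\<close> and
  \<open>U\<close> their endpoints. No other edge of \<open>M\<close> can lie inside
  \<open>T \<union> U\<close>, since each vertex there is already used.\<close>

lemma matched_subsets_exist:
  assumes M: "M \<in> perfect_matchings L R" and fin: "finite L" "finite R" and disj: "L \<inter> R = {}"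
    and t: "t \<le> card (inner_edges M S)"
  shows "\<exists>T U. T \<subseteq> S \<inter> L \<and> U \<subseteq> S \<inter> R \<and> card T = t \<and> card U = t
    \<and> inner_edges M (T \<union> U) \<in> perfect_matchings T U"
proof -
  obtain F where F: "F \<subseteq> inner_edges M S" "card F = t"
    using t by (meson obtain_subset_with_card_n)
  then have FM: "F \<subseteq> M" and FS: "\<Union>F \<subseteq> S" by (auto simp: inner_edges_def)
  define T U where "T = \<Union>F \<inter> L" and "U = \<Union>F \<inter> R"
  have UF: "\<Union>F \<subseteq> L \<union> R" using perfect_matchings_Union[OF M] FM by blast
  have F_pm: "F \<in> perfect_matchings T U"
  proof (rule perfect_matchingsI)
    fix e assume e: "e \<in> F"
    then obtain u v where "u \<in> L" "v \<in> R" "e = {u, v}" using perfect_matchings_edge[OF M] FM by blast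
    then show "\<exists>u\<in>T. \<exists>v\<in>U. e = {u, v}" using e unfolding T_def U_def by blast
  next
    fix x e f assume "e \<in> F" "f \<in> F" "x \<in> e" "x \<in> f"
    then show "e = f" using perfect_matchings_unique[OF M] FM by blast
  qed (auto simp: T_def U_def)
  have "inner_edges M (T \<union> U) = F"
  proof (intro equalityI subsetI)
    fix e assume e: "e \<in> inner_edges M (T \<union> U)"
    then have eM: "e \<in> M" and "e \<subseteq> \<Union>F" by (auto simp: inner_edges_def T_def U_def)
    moreover have "e \<noteq> {}" using perfect_matchings_edge[OF M eM] by blast
    ultimately obtain x f where "x \<in> e" "f \<in> F" "x \<in> f" by blast
    then show "e \<in> F" using perfect_matchings_unique[OF M eM] FM by blast
  next
    fix e assume e: "e \<in> F"
    then show "e \<in> inner_edges M (T \<union> U)"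
      using FM UF by (auto simp: inner_edges_def T_def U_def)
  qed
  moreover have "card T = t" "card U = t"
    using card_perfect_matching[OF F_pm] F fin disj by (auto simp: T_def U_def)
  moreover have "T \<subseteq> S \<inter> L" "U \<subseteq> S \<inter> R" using FS by (auto simp: T_def U_def)
  ultimately show ?thesis using F_pm by auto
qed

lemma binomial_mult_le: "(a choose t) * (c choose t) \<le> (a + c) choose (2 * t)"
proof -
  have "(a choose t) * (c choose (2 * t - t)) \<le> (\<Sum>k\<le>2 * t. (a choose k) * (c choose (2 * t - k)))"
    by (rule member_le_sum) auto
  then show ?thesis by (simp add: vandermonde)
qed

text \<open>Union bound over the pairs \<open>(T, U)\<close> of matched \<open>t\<close>-sets: each
  pair is matched internally with probability at most \<open>1 / (n choose t)\<close>, and by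
  Vandermonde there are at most \<open>k choose (2 * t)\<close> pairs inside
  \<open>S\<close>.\<close>

lemma prob_perfect_matching_inner_edges:
  assumes fin: "finite L" "finite R" and eq: "card L = n" "card R = n" and disj: "L \<inter> R = {}"
    and S: "finite S" "card S = k"
  shows "measure_pmf.prob (pmf_of_set (perfect_matchings L R)) {M. t \<le> card (inner_edges M S)}
    \<le> real (k choose (2 * t)) / real (n choose t)"
proof (cases "t \<le> n")
  \<comment> \<open>Here the right-hand side divides by zero and equals 0, so the event must be
    shown to be impossible.\<close>
  case False
  have "card (inner_edges M S) < t" if "M \<in> perfect_matchings L R" for M
  proof -
    have "card (inner_edges M S) \<le> card M" using finite_perfect_matching[OF that fin]
      by (intro card_mono) (auto simp: inner_edges_def)
    also have "\<dots> = n" using card_perfect_matching[OF that fin disj] eq by simp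
    finally show ?thesis using False by simp
  qed
  then have "perfect_matchings L R \<inter> {M. t \<le> card (inner_edges M S)} = {}" by fastforce
  moreover have "perfect_matchings L R \<noteq> {}"
    using card_perfect_matchings[OF fin _ disj] eq by (metis card.empty fact_nonzero)
  ultimately show ?thesis
    using measure_pmf_of_set[of "perfect_matchings L R"] finite_perfect_matchings[OF fin] by simp
next
  case True
  let ?PM = "perfect_matchings L R"
  let ?Ts = "{T. T \<subseteq> S \<inter> L \<and> card T = t}" and ?Us = "{U. U \<subseteq> S \<inter> R \<and> card U = t}"
  let ?X = "\<lambda>(T, U). {M \<in> ?PM. inner_edges M (T \<union> U) \<in> perfect_matchings T U}"
  have cPM: "card ?PM = fact n" using card_perfect_matchings[OF fin _ disj] eq by simp
  have finPM: "finite ?PM" using finite_perfect_matchings[OF fin] .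
  have ne: "?PM \<noteq> {}" using cPM by (metis card.empty fact_nonzero)
  have finTU: "finite (?Ts \<times> ?Us)" using S by simp
  have "card (?PM \<inter> {M. t \<le> card (inner_edges M S)}) \<le> card (\<Union>TU\<in>?Ts \<times> ?Us. ?X TU)"
  proof (rule card_mono)
    show "finite (\<Union>TU\<in>?Ts \<times> ?Us. ?X TU)" by (rule finite_subset[OF _ finPM]) auto
    show "?PM \<inter> {M. t \<le> card (inner_edges M S)} \<subseteq> (\<Union>TU\<in>?Ts \<times> ?Us. ?X TU)"
    proof
      fix M assume "M \<in> ?PM \<inter> {M. t \<le> card (inner_edges M S)}"
      then have M: "M \<in> ?PM" "t \<le> card (inner_edges M S)" by auto
      obtain T U where "T \<subseteq> S \<inter> L" "U \<subseteq> S \<inter> R" "card T = t" "card U = t"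
        "inner_edges M (T \<union> U) \<in> perfect_matchings T U"
        using matched_subsets_exist[OF M(1) fin disj M(2)] by blast
      then show "M \<in> (\<Union>TU\<in>?Ts \<times> ?Us. ?X TU)" using M by (intro UN_I[of "(T, U)"]) auto
    qed
  qed
  also have "\<dots> \<le> (\<Sum>TU\<in>?Ts \<times> ?Us. card (?X TU))" using finTU by (rule card_UN_le)
  also have "\<dots> \<le> (\<Sum>TU\<in>?Ts \<times> ?Us. fact t * fact (n - t))"
  proof (rule sum_mono)
    fix TU assume "TU \<in> ?Ts \<times> ?Us"
    then show "card (?X TU) \<le> fact t * fact (n - t)"
      using card_perfect_matchings_restricted[OF fin _ disj, of "fst TU" "snd TU" t] eq by auto
  qed
  also have "\<dots> = (card (S \<inter> L) choose t) * (card (S \<inter> R) choose t) * (fact t * fact (n - t))"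
    using S n_subsets[of "S \<inter> L" t] n_subsets[of "S \<inter> R" t] by (simp add: card_cartesian_product)
  also have "\<dots> \<le> (k choose (2 * t)) * (fact t * fact (n - t))"
  proof (rule mult_right_mono)
    have "card (S \<inter> L) + card (S \<inter> R) = card (S \<inter> L \<union> S \<inter> R)"
      using S disj by (intro card_Un_disjoint[symmetric]) auto
    also have "\<dots> \<le> k" using S by (auto intro!: card_mono)
    finally show "(card (S \<inter> L) choose t) * (card (S \<inter> R) choose t) \<le> k choose (2 * t)"
      using binomial_mult_le binomial_right_mono order_trans by metis
  qed simp
  finally have "real (card (?PM \<inter> {M. t \<le> card (inner_edges M S)}))
    \<le> real ((k choose (2 * t)) * (fact t * fact (n - t)))" using of_nat_le_iff by blast
  then have "real (card (?PM \<inter> {M. t \<le> card (inner_edges M S)})) / fact n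
    \<le> real (k choose (2 * t)) * (fact t * fact (n - t)) / fact n"
    by (intro divide_right_mono) auto
  also have "\<dots> = real (k choose (2 * t)) / real (n choose t)"
    using True by (simp add: binomial_fact)
  finally show ?thesis
    using measure_pmf_of_set[OF ne finPM] cPM by simp
qed

section \<open>First moment bounds\<close>

text \<open>The union bound in a form where the covering is only checked on the support, so that
  outcomes may be assumed to be perfect matchings.\<close>

lemma prob_le_sum:
  assumes "finite I" "\<And>\<omega>. \<omega> \<in> set_pmf p \<Longrightarrow> \<omega> \<in> A \<Longrightarrow> \<exists>i\<in>I. \<omega> \<in> B i"
  shows "measure_pmf.prob p A \<le> (\<Sum>i\<in>I. measure_pmf.prob p (B i))"
proof -
  have "measure_pmf.prob p A = measure_pmf.prob p (A \<inter> set_pmf p)"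
    by (simp add: measure_Int_set_pmf)
  also have "\<dots> \<le> measure_pmf.prob p (\<Union>i\<in>I. B i)"
    using assms(2) by (intro measure_pmf.finite_measure_mono) auto
  also have "\<dots> \<le> (\<Sum>i\<in>I. measure_pmf.prob p (B i))"
    using assms(1) by (intro measure_pmf.finite_measure_subadditive_finite) auto
  finally show ?thesis .
qed

lemma prob_pair_pmf_Times:
  "measure_pmf.prob (pair_pmf p q) (A \<times> B) = measure_pmf.prob p A * measure_pmf.prob q B"
proof -
  have "measure_pmf.prob (pair_pmf p q) (A \<times> B) =
      measure_pmf.prob (pair_pmf p q) ((A \<inter> set_pmf p) \<times> (B \<inter> set_pmf q))"
    by (subst measure_Int_set_pmf[symmetric]) (simp add: Times_Int_Times)
  also have "\<dots> = measure_pmf.prob p (A \<inter> set_pmf p) * measure_pmf.prob q (B \<inter> set_pmf q)"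
    by (intro measure_pmf_prob_product) (auto intro: countable_subset[OF _ countable_set_pmf])
  finally show ?thesis by (simp add: measure_Int_set_pmf)
qed

text \<open>Marking \<open>t\<close> vertices of \<open>S\<close> on each side overcounts, but it
  produces the factor \<open>(b choose t)\<close> squared, which later cancels against the
  probabilities of two matchings.\<close>

lemma card_sets_meeting_both_sides_le:
  assumes "finite L" "finite R" "card L = b" "card R = b" "L \<inter> R = {}"
  shows "card {S. S \<subseteq> L \<union> R \<and> card S = 2 * t + r \<and> t \<le> card (S \<inter> L) \<and> t \<le> card (S \<inter> R)}
    \<le> (b choose t) * (b choose t) * (2 * b choose r)" (is "card ?X \<le> _")
proof -
  let ?Y = "{T. T \<subseteq> L \<and> card T = t} \<times> {U. U \<subseteq> R \<and> card U = t} \<times> {Z. Z \<subseteq> L \<union> R \<and> card Z = r}"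
  have fin: "finite ?Y" using assms by simp
  have "?X \<subseteq> (\<lambda>(T, U, Z). T \<union> U \<union> Z) ` ?Y"
  proof
    fix S assume S: "S \<in> ?X"
    then have fS: "finite S" using assms finite_subset by blast
    obtain T where T: "T \<subseteq> S \<inter> L" "card T = t" using S by (auto intro: obtain_subset_with_card_n)
    obtain U where U: "U \<subseteq> S \<inter> R" "card U = t" using S by (auto intro: obtain_subset_with_card_n)
    have fTU: "finite T" "finite U" using T U fS finite_subset by blast+
    have "card (T \<union> U) = 2 * t" using T U fTU assms(5) by (subst card_Un_disjoint) auto
    then have "card (S - (T \<union> U)) = r"
      using S T U fTU by (subst card_Diff_subset) auto
    moreover have "S = T \<union> U \<union> (S - (T \<union> U))" using T U by blast
    ultimately show "S \<in> (\<lambda>(T, U, Z). T \<union> U \<union> Z) ` ?Y"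
      using S T U by (intro image_eqI[of _ _ "(T, U, S - (T \<union> U))"]) auto
  qed
  then have "card ?X \<le> card ?Y" using fin by (rule surj_card_le[rotated])
  also have "\<dots> = (b choose t) * (b choose t) * (2 * b choose r)"
    using assms by (simp add: n_subsets card_cartesian_product card_Un_disjoint mult_2)
  finally show ?thesis .
qed

text \<open>Combines \<open>k choose (2 * t) \<le> 2 ^ k\<close> with
  \<open>n choose t \<ge> (n / t) ^ t\<close>, \<open>t \<le> k\<close> and
  \<open>n \<ge> b / 2\<close>. The slack in \<open>b \<le> 2 * n\<close> admits the matching of the
  non-ports, where \<open>n = b - p\<close>.\<close>

lemma binomial_ratio_le:
  assumes "b \<le> 2 * n" "0 < b"
  shows "real (k choose (2 * t)) / real (n choose t) \<le> 2 ^ k * (2 * real k / real b) ^ t"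
proof (cases "t \<le> k \<and> t \<le> n \<and> t > 0")
  case True
  have n: "real b \<le> 2 * real n" using assms by linarith
  have "(real n / real t) ^ t \<le> real (n choose t)" using True binomial_ge_n_over_k_pow_k by blast
  moreover have "0 < (real n / real t) ^ t" using True by simp
  moreover have "real (k choose (2 * t)) \<le> 2 ^ k"
    using binomial_le_pow2[of k "2 * t"] by (metis of_nat_le_iff of_nat_numeral of_nat_power)
  ultimately have "real (k choose (2 * t)) / real (n choose t) \<le> 2 ^ k / (real n / real t) ^ t"
    by (intro frac_le) simp_all
  also have "\<dots> = 2 ^ k * (real t / real n) ^ t" by (simp add: power_divide)
  also have "real t / real n \<le> real k / (real b / 2)"
    using True n assms by (intro frac_le) auto
  then have "2 ^ k * (real t / real n) ^ t \<le> 2 ^ k * (real k / (real b / 2)) ^ t"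
    by (intro mult_left_mono power_mono) auto
  finally show ?thesis by (simp add: mult.commute)
next
  case False
  \<comment> \<open>For \<open>t > k\<close> the numerator is 0; for \<open>t > n\<close> the
    denominator is, and the quotient is 0 by convention.\<close>
  then consider "t = 0" | "t > k" | "t > n" by linarith
  then show ?thesis by cases (auto simp: binomial_eq_0)
qed

text \<open>A Chernoff-type bound: one term of the expansion of
  \<open>(\<theta> / 2 + 1) ^ (2 * b)\<close> is at most the whole. As
  \<open>\<theta> \<le> 2\<close>, the logarithm is nonnegative and \<open>r\<close> may be replaced
  by its upper bound.\<close>

lemma binomial_le_exp:
  assumes "0 < \<theta>" "\<theta> \<le> 2" "real r \<le> \<theta> * real b"
  shows "real (2 * b choose r) \<le> exp (\<theta> * real b * (1 + ln (2 / \<theta>)))"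
proof (cases "r \<le> 2 * b")
  case False
  then show ?thesis by (simp add: binomial_eq_0)
next
  case True
  have "real (2 * b choose r) * (\<theta> / 2) ^ r \<le> (\<Sum>k\<le>2 * b. real (2 * b choose k) * (\<theta> / 2) ^ k)"
    using True assms by (intro member_le_sum) auto
  also have "\<dots> = (\<theta> / 2 + 1) ^ (2 * b)" by (simp add: binomial_ring)
  also have "\<dots> \<le> exp (\<theta> / 2) ^ (2 * b)"
    using assms exp_ge_add_one_self[of "\<theta> / 2"]
    by (intro power_mono) (auto simp: add.commute simp del: exp_ge_add_one_self)
  also have "\<dots> = exp (\<theta> * real b)" by (simp flip: exp_of_nat_mult)
  finally have "real (2 * b choose r) \<le> exp (\<theta> * real b) * (2 / \<theta>) ^ r"
    using assms by (simp add: field_simps power_divide)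
  also have "(2 / \<theta>) ^ r = exp (real r * ln (2 / \<theta>))"
    using assms by (simp add: exp_of_nat_mult)
  also have "real r * ln (2 / \<theta>) \<le> \<theta> * real b * ln (2 / \<theta>)"
    using assms by (intro mult_right_mono) auto
  finally show ?thesis by (simp add: algebra_simps flip: exp_add)
qed

lemma sum_subsets_prod_le_exp:
  fixes w :: "'a \<Rightarrow> real"
  assumes "finite V" "\<And>v. v \<in> V \<Longrightarrow> 0 \<le> w v"
  shows "(\<Sum>S\<in>Pow V. \<Prod>v\<in>S. w v) \<le> exp (\<Sum>v\<in>V. w v)"
proof -
  have "(\<Sum>S\<in>Pow V. \<Prod>v\<in>S. w v) = (\<Prod>v\<in>V. w v + 1)"
    using assms(1) by (simp add: prod_add)
  also have "\<dots> \<le> (\<Prod>v\<in>V. exp (w v))"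
    using assms(2) by (intro prod_mono) (auto simp: add.commute)
  finally show ?thesis using assms(1) by (simp add: exp_sum)
qed

section \<open>A fixed port set and three random matchings\<close>

locale port_split =
  fixes L R P :: "'v set" and b p :: nat
  assumes fin: "finite L" "finite R" and card_LR: "card L = b" "card R = b"
    and disj: "L \<inter> R = {}" and P_sub: "P \<subseteq> L \<union> R"
    and card_P: "card (P \<inter> L) = p" "card (P \<inter> R) = p"
begin

lemma fin_P: "finite P" using P_sub fin finite_subset by blast

lemma card_P_total: "card P = 2 * p"
proof -
  have "P = (P \<inter> L) \<union> (P \<inter> R)" using P_sub by blast
  then have "card P = card (P \<inter> L) + card (P \<inter> R)"
    using card_Un_disjoint[of "P \<inter> L" "P \<inter> R"] fin disj by auto
  then show ?thesis using card_P by simp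
qed

lemma card_V: "card (L \<union> R) = 2 * b"
  using card_Un_disjoint[OF fin disj] card_LR by simp

lemma card_LR_minus_P: "card (L - P) = b - p" "card (R - P) = b - p"
  using card_Diff_subset_Int[of L P] card_Diff_subset_Int[of R P] fin card_P card_LR
  by (simp_all add: Int_commute)

text \<open>For \<open>d \<ge> 3\<close> the random graph contains at least two matchings of all
  vertices and one of the non-ports. Counted with multiplicity, a non-port has degree 3 in the
  triple and a port degree 2.\<close>

definition triple_pmf :: "('v set set \<times> 'v set set \<times> 'v set set) pmf" where
  "triple_pmf = pair_pmf (pmf_of_set (perfect_matchings L R))
     (pair_pmf (pmf_of_set (perfect_matchings L R)) (pmf_of_set (perfect_matchings (L - P) (R - P))))"

lemma perfect_matchings_nonempty:
  "perfect_matchings L R \<noteq> {}" "perfect_matchings (L - P) (R - P) \<noteq> {}"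
proof -
  have "card (perfect_matchings L R) \<noteq> 0"
    using card_perfect_matchings[OF fin _ disj] card_LR by simp
  then show "perfect_matchings L R \<noteq> {}" by auto
  have "card (perfect_matchings (L - P) (R - P)) \<noteq> 0"
    using card_perfect_matchings[of "L - P" "R - P"] fin disj card_LR_minus_P by fastforce
  then show "perfect_matchings (L - P) (R - P) \<noteq> {}" by auto
qed

lemma set_triple_pmf:
  "set_pmf triple_pmf =
    perfect_matchings L R \<times> perfect_matchings L R \<times> perfect_matchings (L - P) (R - P)"
  unfolding triple_pmf_def using perfect_matchings_nonempty fin
  by (simp add: finite_perfect_matchings)

text \<open>An edge lying in several of the matchings is counted once for each, so that the three
  summands are independent.\<close>

definition inner_count :: "'v set set \<times> 'v set set \<times> 'v set set \<Rightarrow> 'v set \<Rightarrow> nat" where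
  "inner_count = (\<lambda>(M1, M2, N) S.
     card (inner_edges M1 S) + card (inner_edges M2 S) + card (inner_edges N S))"

lemma prob_triple_inner_edges:
  assumes S: "finite S" "card S = k"
  shows "measure_pmf.prob triple_pmf {(M1, M2, N).
      t1 \<le> card (inner_edges M1 S) \<and> t2 \<le> card (inner_edges M2 S) \<and> t3 \<le> card (inner_edges N S)}
    \<le> (real (k choose (2 * t1)) / real (b choose t1)) * ((real (k choose (2 * t2)) / real (b choose t2))
      * (real (k choose (2 * t3)) / real ((b - p) choose t3)))"
proof -
  have "{(M1, M2, N). t1 \<le> card (inner_edges M1 S) \<and> t2 \<le> card (inner_edges M2 S) \<and> t3 \<le> card (inner_edges N S)}
    = {M. t1 \<le> card (inner_edges M S)} \<times> {M. t2 \<le> card (inner_edges M S)} \<times> {M. t3 \<le> card (inner_edges M S)}"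
    by auto
  moreover have "(L - P) \<inter> (R - P) = {}" using disj by blast
  ultimately show ?thesis
    unfolding triple_pmf_def
    using fin disj card_LR card_LR_minus_P S
    by (simp only: prob_pair_pmf_Times)
      (intro mult_mono prob_perfect_matching_inner_edges mult_nonneg_nonneg; (assumption | simp))
qed

text \<open>There are at most \<open>(k + 1) ^ 3 \<le> 8 ^ k\<close> ways to distribute the inner
  edges over the matchings, and each has probability at most
  \<open>8 ^ k * u ^ (t1 + t2 + t3)\<close>. Since \<open>2 * k \<le> b\<close> gives
  \<open>u \<le> 1\<close>, the exponent may be lowered to the real number \<open>x\<close>.\<close>

lemma prob_inner_count_ge:
  assumes S: "finite S" "card S = k" and k: "0 < k" "2 * k \<le> b" and p: "2 * p \<le> b"
  shows "measure_pmf.prob triple_pmf {Ms. x \<le> real (inner_count Ms S)}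
    \<le> 64 ^ k * (2 * real k / real b) powr x"
proof -
  define u where "u = 2 * real k / real b"
  have b: "0 < b" using k by simp
  have u: "0 < u" "u \<le> 1" using k b unfolding u_def by (simp_all add: field_simps)
  let ?I = "{(t1, t2, t3). t1 \<le> k \<and> t2 \<le> k \<and> t3 \<le> k \<and> x \<le> real (t1 + t2 + t3)}"
  have I_sub: "?I \<subseteq> {..k} \<times> {..k} \<times> {..k}" by auto
  then have I: "finite ?I" by (rule finite_subset) auto
  let ?B = "\<lambda>(t1, t2, t3). {(M1, M2, N).
      t1 \<le> card (inner_edges M1 S) \<and> t2 \<le> card (inner_edges M2 S) \<and> t3 \<le> card (inner_edges N S)}"
  have "measure_pmf.prob triple_pmf {Ms. x \<le> real (inner_count Ms S)}
    \<le> (\<Sum>t\<in>?I. measure_pmf.prob triple_pmf (?B t))"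
  proof (rule prob_le_sum[OF I])
    fix Ms assume Ms: "Ms \<in> set_pmf triple_pmf" "Ms \<in> {Ms. x \<le> real (inner_count Ms S)}"
    obtain M1 M2 N where eq: "Ms = (M1, M2, N)" by (cases Ms)
    have le: "card (inner_edges M S) \<le> k" if "M \<in> perfect_matchings A B" "finite A" "finite B" "A \<inter> B = {}"
      for M A B
    proof -
      have "card (S \<inter> (A \<union> B)) \<le> k" using S by (auto intro: card_mono)
      then show ?thesis using card_perfect_matching_edges[OF that, of S] by linarith
    qed
    have "card (inner_edges M1 S) \<le> k" "card (inner_edges M2 S) \<le> k"
      using Ms(1) le[of M1 L R] le[of M2 L R] fin disj unfolding set_triple_pmf eq by auto
    moreover have "card (inner_edges N S) \<le> k"
      using Ms(1) fin disj unfolding set_triple_pmf eq by (intro le[of N "L - P" "R - P"]) auto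
    ultimately show "\<exists>t\<in>?I. Ms \<in> ?B t" using Ms(2) unfolding eq inner_count_def
      by (intro bexI[of _ "(card (inner_edges M1 S), card (inner_edges M2 S), card (inner_edges N S))"])
        auto
  qed
  also have "\<dots> \<le> (\<Sum>t\<in>?I. 8 ^ k * u powr x)"
  proof (rule sum_mono)
    fix t assume "t \<in> ?I"
    then obtain t1 t2 t3 where t: "t = (t1, t2, t3)" and x: "x \<le> real (t1 + t2 + t3)" by auto
    have bp: "b \<le> 2 * (b - p)" using p by linarith
    have "measure_pmf.prob triple_pmf (?B t) \<le>
      (real (k choose (2 * t1)) / real (b choose t1)) * ((real (k choose (2 * t2)) / real (b choose t2))
      * (real (k choose (2 * t3)) / real ((b - p) choose t3)))"
      unfolding t using prob_triple_inner_edges[OF S] by simp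
    also have "\<dots> \<le> (2 ^ k * u ^ t1) * ((2 ^ k * u ^ t2) * (2 ^ k * u ^ t3))"
      unfolding u_def using b bp by (intro mult_mono binomial_ratio_le) auto
    also have "\<dots> = 8 ^ k * u ^ (t1 + t2 + t3)"
      by (simp add: power_add mult_ac flip: power_mult_distrib)
    also have "u ^ (t1 + t2 + t3) = u powr real (t1 + t2 + t3)" using u by (subst powr_realpow) auto
    also have "\<dots> \<le> u powr x" using u x by (intro powr_mono') auto
    finally show "measure_pmf.prob triple_pmf (?B t) \<le> 8 ^ k * u powr x" by simp
  qed
  also have "\<dots> = real (card ?I) * (8 ^ k * u powr x)" by simp
  also have "\<dots> \<le> 8 ^ k * (8 ^ k * u powr x)"
  proof (rule mult_right_mono)
    have "card ?I \<le> card ({..k} \<times> {..k} \<times> {..k})" using I_sub by (intro card_mono) auto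
    also have "\<dots> = Suc k ^ 3" by (simp add: card_cartesian_product power3_eq_cube mult.assoc)
    also have "\<dots> \<le> (2 ^ k) ^ 3"
    proof -
      have "k < 2 ^ k" by (rule less_exp)
      then show ?thesis by (intro power_mono) linarith+
    qed
    also have "(2 ^ k) ^ 3 = (2 ^ 3 :: nat) ^ k" by (metis mult.commute power_mult)
    also have "\<dots> = 8 ^ k" by simp
    finally have "real (card ?I) \<le> real (8 ^ k)" by (simp only: of_nat_le_iff)
    then show "real (card ?I) \<le> 8 ^ k" by simp
  qed simp
  also have "\<dots> = 64 ^ k * u powr x" by (simp flip: power_mult_distrib)
  finally show ?thesis unfolding u_def .
qed

end

lemma sum_half_powers_le: "(\<Sum>k\<in>{1..n}. (1 / 2 :: real) ^ k) \<le> 1"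
proof -
  have "(\<Sum>k\<in>{1..n}. (1 / 2 :: real) ^ k) = 1 - (1 / 2) ^ n"
    by (induction n) (simp_all add: field_simps)
  then show ?thesis by simp
qed

section \<open>Small sets: first moment of the sets spanning too many edges\<close>

context port_split
begin

text \<open>There are at most about b^(i + j/4) sets with i non-ports and j ports, and spanning x
  edges costs about (k/b)^x for k = i + j. The threshold is the critical exponent i + j/4 plus a
  margin of k/8, which has to absorb the factors exponential in k and still leave decay in
  b.\<close>

definition crowded :: "'v set set \<times> 'v set set \<times> 'v set set \<Rightarrow> 'v set \<Rightarrow> bool" where
  "crowded Ms S \<longleftrightarrow>
    real (card (S - P)) + real (card (S \<inter> P)) / 4 + real (card S) / 8 \<le> real (inner_count Ms S)"

text \<open>
  Dropping the constraint on \<open>card S\<close> turns the sum into a product over the vertices; since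
  \<open>u b = 2 k\<close> and \<open>u\<^bsup>1/4\<^esup> p \<le> (2 k)\<^bsup>1/4\<^esup>\<close>, this costs only a factor exponential in \<open>k\<close>.
\<close>

lemma sum_sets_powr_le:
  assumes k: "0 < k" "2 * k \<le> b" and p: "real p \<le> real b powr (1 / 4)"
  defines "u \<equiv> 2 * real k / real b"
  shows "(\<Sum>S | S \<subseteq> L \<union> R \<and> card S = k. u powr (real (card (S - P)) + real (card (S \<inter> P)) / 4))
    \<le> exp (8 * real k)"
proof -
  have u: "0 < u" using k unfolding u_def by simp
  define w where "w = (\<lambda>v. if v \<in> P then u powr (1 / 4) else u)"
  have w: "0 \<le> w v" for v using u by (simp add: w_def)
  have "(\<Sum>S | S \<subseteq> L \<union> R \<and> card S = k. u powr (real (card (S - P)) + real (card (S \<inter> P)) / 4))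
    = (\<Sum>S | S \<subseteq> L \<union> R \<and> card S = k. \<Prod>v\<in>S. w v)"
  proof (rule sum.cong[OF refl])
    fix S assume "S \<in> {S. S \<subseteq> L \<union> R \<and> card S = k}"
    then have S: "finite S" using fin finite_subset by blast
    have "(\<Prod>v\<in>S. w v) = (\<Prod>v\<in>S - P. w v) * (\<Prod>v\<in>S \<inter> P. w v)"
      using prod.union_disjoint[of "S - P" "S \<inter> P" w] S by (simp add: Un_Diff_Int Diff_Int_distrib2)
    also have "\<dots> = u ^ card (S - P) * (u powr (1 / 4)) ^ card (S \<inter> P)" by (simp add: w_def)
    also have "\<dots> = u powr (real (card (S - P)) + real (card (S \<inter> P)) / 4)"
      using u by (simp add: powr_add powr_realpow powr_powr flip: powr_realpow)
    finally show "u powr (real (card (S - P)) + real (card (S \<inter> P)) / 4) = (\<Prod>v\<in>S. w v)" ..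
  qed
  also have "\<dots> \<le> (\<Sum>S\<in>Pow (L \<union> R). \<Prod>v\<in>S. w v)"
    using fin w by (intro sum_mono2) (auto intro: prod_nonneg)
  also have "\<dots> \<le> exp (\<Sum>v\<in>L \<union> R. w v)"
    using fin w by (intro sum_subsets_prod_le_exp) auto
  also have "(\<Sum>v\<in>L \<union> R. w v) \<le> (\<Sum>v\<in>L \<union> R. u + of_bool (v \<in> P) * u powr (1 / 4))"
    using u by (intro sum_mono) (simp add: w_def)
  also have "\<dots> = real (card (L \<union> R)) * u + real (card ((L \<union> R) \<inter> P)) * u powr (1 / 4)"
    using fin by (simp add: sum.distrib flip: sum_distrib_right)
  also have "(L \<union> R) \<inter> P = P" using P_sub by blast
  also have "real (card (L \<union> R)) * u + real (card P) * u powr (1 / 4)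
      = 4 * real k + 2 * (real p * u powr (1 / 4))"
    using k by (simp add: card_V card_P_total u_def)
  also have "real p * u powr (1 / 4) \<le> real b powr (1 / 4) * u powr (1 / 4)"
    using p by (intro mult_right_mono) auto
  also have "\<dots> = (2 * real k) powr (1 / 4)"
    using k by (simp add: u_def flip: powr_mult)
  also have "\<dots> \<le> (2 * real k) powr 1" using k by (intro powr_mono) auto
  also have "\<dots> = 2 * real k" using k by simp
  finally show ?thesis by simp
qed

lemma prob_exists_crowded:
  assumes b: "0 < b" and p: "real p \<le> real b powr (1 / 4)" "2 * p \<le> b"
    and \<epsilon>: "0 < \<epsilon>" "\<epsilon> \<le> 1 / 2" "64 * exp 8 * (2 * \<epsilon>) powr (1 / 16) \<le> 1 / 4"
  shows "measure_pmf.prob triple_pmf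
    {Ms. \<exists>S\<subseteq>L \<union> R. S \<noteq> {} \<and> real (card S) \<le> \<epsilon> * real b \<and> crowded Ms S} \<le> real b powr (- 1 / 16)"
proof -
  define K where "K = nat \<lfloor>\<epsilon> * real b\<rfloor>"
  define u where "u = (\<lambda>k. 2 * real k / real b)"
  define f where "f S = real (card (S - P)) + real (card (S \<inter> P)) / 4" for S
  let ?X = "\<lambda>k. {S. S \<subseteq> L \<union> R \<and> card S = k}"
  have K: "real k \<le> \<epsilon> * real b" "2 * k \<le> b" if "k \<in> {1..K}" for k
  proof -
    show *: "real k \<le> \<epsilon> * real b" using that \<epsilon> unfolding K_def by (auto simp: le_nat_iff le_floor_iff)
    have "\<epsilon> * real b \<le> 1 / 2 * real b" using \<epsilon> by (intro mult_right_mono) auto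
    then show "2 * k \<le> b" using * by linarith
  qed
  have "measure_pmf.prob triple_pmf
      {Ms. \<exists>S\<subseteq>L \<union> R. S \<noteq> {} \<and> real (card S) \<le> \<epsilon> * real b \<and> crowded Ms S}
    \<le> (\<Sum>(k, S)\<in>Sigma {1..K} ?X. measure_pmf.prob triple_pmf {Ms. crowded Ms S})"
    unfolding case_prod_beta
  proof (rule prob_le_sum)
    show "finite (Sigma {1..K} ?X)" using fin by (intro finite_SigmaI) auto
    fix Ms assume "Ms \<in> {Ms. \<exists>S\<subseteq>L \<union> R. S \<noteq> {} \<and> real (card S) \<le> \<epsilon> * real b \<and> crowded Ms S}"
    then obtain S where S: "S \<subseteq> L \<union> R" "S \<noteq> {}" "real (card S) \<le> \<epsilon> * real b" "crowded Ms S" by blast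
    have "finite S" using S(1) fin finite_subset by blast
    then have "card S \<noteq> 0" using S(2) by simp
    moreover have "card S \<le> K" using S(3) unfolding K_def by (simp add: le_nat_floor)
    ultimately show "\<exists>i\<in>Sigma {1..K} ?X. Ms \<in> {Ms. crowded Ms (snd i)}"
      using S by (intro bexI[of _ "(card S, S)"]) auto
  qed
  also have "\<dots> = (\<Sum>k\<in>{1..K}. \<Sum>S\<in>?X k. measure_pmf.prob triple_pmf {Ms. crowded Ms S})"
    using fin by (subst sum.Sigma) auto
  also have "\<dots> \<le> (\<Sum>k\<in>{1..K}. (1 / 2) ^ k * real b powr (- 1 / 16))"
  proof (rule sum_mono)
    fix k assume k: "k \<in> {1..K}"
    then have k0: "0 < k" by simp
    have u: "0 < u k" "u k \<le> 2 * \<epsilon>" "u k \<le> 1" using K[OF k] b k0 \<epsilon> unfolding u_def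
      by (simp_all add: field_simps)
    have "(\<Sum>S\<in>?X k. measure_pmf.prob triple_pmf {Ms. crowded Ms S})
      \<le> (\<Sum>S\<in>?X k. 64 ^ k * u k powr (f S + real k / 8))"
    proof (rule sum_mono)
      fix S assume S: "S \<in> ?X k"
      then have "finite S" using fin finite_subset by blast
      then show "measure_pmf.prob triple_pmf {Ms. crowded Ms S} \<le> 64 ^ k * u k powr (f S + real k / 8)"
        using prob_inner_count_ge[OF _ _ k0 K(2)[OF k] p(2), of S "f S + real k / 8"] S
        unfolding u_def crowded_def f_def by simp
    qed
    also have "\<dots> = 64 ^ k * u k powr (real k / 8) * (\<Sum>S\<in>?X k. u k powr f S)"
      by (simp add: powr_add sum_distrib_left mult_ac)
    also have "\<dots> \<le> 64 ^ k * u k powr (real k / 8) * exp (8 * real k)"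
      using sum_sets_powr_le[OF k0 K(2)[OF k] p(1)] unfolding u_def f_def
      by (intro mult_left_mono) auto
    \<comment> \<open>The margin is spent in two halves: one beats \<open>64 * exp 8\<close> per
      vertex because \<open>u k \<le> 2 * \<epsilon>\<close>, the other supplies the decay in
      \<open>b\<close>.\<close>
    also have "u k powr (real k / 8) = u k powr (real k / 16) * u k powr (real k / 16)"
      by (simp flip: powr_add)
    also have "64 ^ k * (u k powr (real k / 16) * u k powr (real k / 16)) * exp (8 * real k)
        = (64 * exp 8 * u k powr (1 / 16)) ^ k * u k powr (real k / 16)"
    proof -
      have "exp (8 * real k) = exp 8 ^ k" by (simp add: exp_of_nat_mult mult.commute[of 8])
      moreover have "u k powr (real k / 16) = (u k powr (1 / 16)) ^ k" using u by (simp add: powr_power)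
      ultimately show ?thesis by (simp only: power_mult_distrib mult_ac)
    qed
    also have "\<dots> \<le> (1 / 4) ^ k * (2 ^ k * real b powr (- 1 / 16))"
    proof (intro mult_mono power_mono)
      have "u k powr (1 / 16) \<le> (2 * \<epsilon>) powr (1 / 16)" using u by (intro powr_mono2) auto
      then have "64 * exp 8 * u k powr (1 / 16) \<le> 64 * exp 8 * (2 * \<epsilon>) powr (1 / 16)"
        by (intro mult_left_mono) auto
      then show "64 * exp 8 * u k powr (1 / 16) \<le> 1 / 4" using \<epsilon> by linarith
      \<comment> \<open>Only the exponent belonging to \<open>k = 1\<close> is kept. The left-over
        power of \<open>2 * k\<close> is absorbed by \<open>2 ^ k\<close>, which together with
        \<open>(1 / 4) ^ k\<close> still gives a summable series.\<close>
      have "u k powr (real k / 16) \<le> u k powr (1 / 16)" using u k0 by (intro powr_mono') auto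
      also have "\<dots> = (2 * real k) powr (1 / 16) * real b powr (- 1 / 16)"
        using b unfolding u_def by (simp add: powr_divide powr_minus_divide)
      also have "\<dots> \<le> 2 ^ k * real b powr (- 1 / 16)"
      proof (rule mult_right_mono)
        have "(2 * real k) powr (1 / 16) \<le> (2 * real k) powr 1" using k0 by (intro powr_mono) auto
        also have "\<dots> = real (2 * k)" using k0 by simp
        also have "2 * k \<le> 2 ^ k"
        proof -
          obtain j where j: "k = Suc j" using k0 by (cases k) auto
          have "Suc j \<le> 2 ^ j" using less_exp[of j] by (rule Suc_leI)
          then show ?thesis unfolding j power_Suc by (rule mult_le_mono2)
        qed
        then have "real (2 * k) \<le> real (2 ^ k)" by (simp only: of_nat_le_iff)
        finally show "(2 * real k) powr (1 / 16) \<le> 2 ^ k" by simp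
      qed simp
      finally show "u k powr (real k / 16) \<le> 2 ^ k * real b powr (- 1 / 16)" .
    qed auto
    also have "\<dots> = (1 / 2) ^ k * real b powr (- 1 / 16)"
      by (simp add: power_mult_distrib[symmetric] mult.assoc[symmetric])
    finally show "(\<Sum>S\<in>?X k. measure_pmf.prob triple_pmf {Ms. crowded Ms S})
      \<le> (1 / 2) ^ k * real b powr (- 1 / 16)" .
  qed
  also have "\<dots> = (\<Sum>k\<in>{1..K}. (1 / 2) ^ k) * real b powr (- 1 / 16)" by (simp add: sum_distrib_right)
  also have "\<dots> \<le> 1 * real b powr (- 1 / 16)" using sum_half_powers_le by (intro mult_right_mono) auto
  finally show ?thesis by simp
qed

section \<open>Sets of linear size: union bound over sets that all three matchings nearly
  preserve\<close>

definition all_inner_ge :: "nat \<Rightarrow> 'v set set \<times> 'v set set \<times> 'v set set \<Rightarrow> 'v set \<Rightarrow> bool" where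
  "all_inner_ge t = (\<lambda>(M1, M2, N) S.
     t \<le> card (inner_edges M1 S) \<and> t \<le> card (inner_edges M2 S) \<and> t \<le> card (inner_edges N S))"

text \<open>Write C for \<open>2 * b choose r\<close>. At most C times the square of
  \<open>b choose t\<close> sets qualify, and each has probability at most C^3 divided by that
  square and by \<open>(b - p) choose t\<close>. Two matchings merely pay for the number of sets,
  the third yields the gain, and C^4 is harmless when \<open>r\<close> is small compared with
  \<open>b\<close>.\<close>

lemma prob_exists_all_inner_ge:
  assumes k: "2 * t + r \<le> 2 * b"
  shows "measure_pmf.prob triple_pmf {Ms. \<exists>S\<subseteq>L \<union> R. card S = 2 * t + r \<and> all_inner_ge t Ms S}
    \<le> real (2 * b choose r) ^ 4 / real ((b - p) choose t)"
proof -
  let ?X = "{S. S \<subseteq> L \<union> R \<and> card S = 2 * t + r \<and> t \<le> card (S \<inter> L) \<and> t \<le> card (S \<inter> R)}"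
  let ?C = "real (2 * b choose r)" and ?c = "real (b choose t)" and ?D = "real ((b - p) choose t)"
  have finX: "finite ?X" using fin by auto
  have "measure_pmf.prob triple_pmf {Ms. \<exists>S\<subseteq>L \<union> R. card S = 2 * t + r \<and> all_inner_ge t Ms S}
    \<le> (\<Sum>S\<in>?X. measure_pmf.prob triple_pmf {Ms. all_inner_ge t Ms S})"
  proof (rule prob_le_sum[OF finX])
    fix Ms assume Ms: "Ms \<in> set_pmf triple_pmf"
      "Ms \<in> {Ms. \<exists>S\<subseteq>L \<union> R. card S = 2 * t + r \<and> all_inner_ge t Ms S}"
    then obtain S where S: "S \<subseteq> L \<union> R" "card S = 2 * t + r" "all_inner_ge t Ms S" by blast
    obtain M1 M2 N where eq: "Ms = (M1, M2, N)" by (cases Ms)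
    have M1: "M1 \<in> perfect_matchings L R" "t \<le> card (inner_edges M1 S)"
      using Ms(1) S(3) unfolding eq set_triple_pmf all_inner_ge_def by auto
    obtain T U where TU: "T \<subseteq> S \<inter> L" "U \<subseteq> S \<inter> R" "card T = t" "card U = t"
      using matched_subsets_exist[OF M1(1) fin disj M1(2)] by blast
    have "t \<le> card (S \<inter> L)" "t \<le> card (S \<inter> R)"
      using card_mono[OF _ TU(1)] card_mono[OF _ TU(2)] TU(3,4) fin by auto
    then show "\<exists>S\<in>?X. Ms \<in> {Ms. all_inner_ge t Ms S}" using S by blast
  qed
  also have "\<dots> \<le> (\<Sum>S\<in>?X. (?C / ?c) * ((?C / ?c) * (?C / ?D)))"
  proof (rule sum_mono)
    fix S assume S: "S \<in> ?X"
    then have fS: "finite S" "card S = 2 * t + r" using fin finite_subset by blast+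
    have "(2 * t + r) choose (2 * t) = (2 * t + r) choose r"
      using binomial_symmetric[of "2 * t" "2 * t + r"] by simp
    also have "\<dots> \<le> 2 * b choose r" using k by (rule binomial_right_mono)
    finally have le: "real ((2 * t + r) choose (2 * t)) \<le> ?C" by simp
    have "measure_pmf.prob triple_pmf {Ms. all_inner_ge t Ms S} \<le>
      (real ((2 * t + r) choose (2 * t)) / ?c) * ((real ((2 * t + r) choose (2 * t)) / ?c)
      * (real ((2 * t + r) choose (2 * t)) / ?D))"
    proof -
      have "{Ms. all_inner_ge t Ms S} = {(M1, M2, N). t \<le> card (inner_edges M1 S) \<and>
          t \<le> card (inner_edges M2 S) \<and> t \<le> card (inner_edges N S)}"
        unfolding all_inner_ge_def by auto
      then show ?thesis using prob_triple_inner_edges[OF fS, of t t t] by simp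
    qed
    also have "\<dots> \<le> (?C / ?c) * ((?C / ?c) * (?C / ?D))"
      using le by (intro mult_mono divide_right_mono) auto
    finally show "measure_pmf.prob triple_pmf {Ms. all_inner_ge t Ms S}
      \<le> (?C / ?c) * ((?C / ?c) * (?C / ?D))" .
  qed
  also have "\<dots> = real (card ?X) * ((?C / ?c) * ((?C / ?c) * (?C / ?D)))" by simp
  also have "\<dots> \<le> (?c * ?c * ?C) * ((?C / ?c) * ((?C / ?c) * (?C / ?D)))"
    using card_sets_meeting_both_sides_le[OF fin card_LR disj, of t r]
    by (intro mult_right_mono) (simp_all flip: of_nat_mult)
  also have "\<dots> \<le> ?C ^ 4 / ?D"
    by (cases "?c = 0") (simp_all add: power4_eq_xxxx)
  finally show ?thesis .
qed

definition small_cuts :: "real \<Rightarrow> 'v set set \<times> 'v set set \<times> 'v set set \<Rightarrow> 'v set \<Rightarrow> bool" where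
  "small_cuts x = (\<lambda>(M1, M2, N) S. real (card (cut_edges M1 S)) \<le> x \<and>
     real (card (cut_edges M2 S)) \<le> x \<and> real (card (cut_edges N S)) \<le> x)"

text \<open>The degree sum of \<open>S\<close> in the matching; the vertices of \<open>S\<close>
  that the matching misses are ports, of which there are \<open>2 * p\<close>.\<close>

lemma inner_edges_ge_of_small_cut:
  assumes M: "M \<in> perfect_matchings A B" and fin': "finite A" "finite B" and disj': "A \<inter> B = {}"
    and S: "finite S" "S - (A \<union> B) \<subseteq> P" and cut: "real (card (cut_edges M S)) \<le> x"
  shows "real (card S) \<le> 2 * real p + x + 2 * real (card (inner_edges M S))"
proof -
  have "card S = card (S \<inter> (A \<union> B)) + card (S - (A \<union> B))"
    using S(1) by (rule card_Int_Diff)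
  also have "card (S - (A \<union> B)) \<le> 2 * p" using card_mono[OF fin_P S(2)] card_P_total by simp
  also have "card (S \<inter> (A \<union> B)) = card (cut_edges M S) + 2 * card (inner_edges M S)"
    using card_perfect_matching_edges[OF M fin' disj'] .
  finally show ?thesis using cut by linarith
qed

text \<open>If no matching has many cut edges at \<open>S\<close>, then each of them pairs up all
  but few vertices of \<open>S\<close> internally, and the previous union bound applies to every
  size \<open>k\<close>. The number of sizes gives the factor \<open>real b + 1\<close>.\<close>

lemma prob_exists_small_cuts:
  assumes \<theta>: "0 < \<theta>" "6 * \<theta> \<le> \<epsilon>" "\<epsilon> \<le> 1" "12 * \<theta> * (1 + ln (2 / (3 * \<theta>))) \<le> \<epsilon> / 8 * ln (3 / 2)"
    and b: "1 \<le> \<theta> * real b" and p: "2 * real p \<le> \<theta> * real b" "4 * p \<le> b"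
  shows "measure_pmf.prob triple_pmf
    {Ms. \<exists>S\<subseteq>L \<union> R. \<epsilon> * real b < real (card S) \<and> card S \<le> b \<and> small_cuts (\<theta> * real b) Ms S}
    \<le> (real b + 1) * exp (- (\<epsilon> / 8 * ln (3 / 2)) * real b)"
proof -
  \<comment> \<open>Bounds the vertices of \<open>S\<close> left without an inner edge: at most
    \<open>2 * p \<le> \<theta> * b\<close> missed ports and at most \<open>\<theta> * b\<close>
    ends of cut edges.\<close>
  define y where "y = nat \<lfloor>2 * \<theta> * real b\<rfloor>"
  define t where "t k = (k - y) div 2" for k
  define K where "K = {k. \<epsilon> * real b < real k \<and> k \<le> b}"
  have y: "real y \<le> 2 * \<theta> * real b" using b \<theta> unfolding y_def by simp
  have finK: "finite K" unfolding K_def by (rule finite_subset[of _ "{..b}"]) auto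
  have \<epsilon>b: "6 * (\<theta> * real b) \<le> \<epsilon> * real b" using mult_right_mono[OF \<theta>(2), of "real b"] by simp
  have "measure_pmf.prob triple_pmf
    {Ms. \<exists>S\<subseteq>L \<union> R. \<epsilon> * real b < real (card S) \<and> card S \<le> b \<and> small_cuts (\<theta> * real b) Ms S}
    \<le> (\<Sum>k\<in>K. measure_pmf.prob triple_pmf
        {Ms. \<exists>S\<subseteq>L \<union> R. card S = 2 * t k + (k - 2 * t k) \<and> all_inner_ge (t k) Ms S})"
  proof (rule prob_le_sum[OF finK])
    fix Ms assume Ms: "Ms \<in> set_pmf triple_pmf"
      "Ms \<in> {Ms. \<exists>S\<subseteq>L \<union> R. \<epsilon> * real b < real (card S) \<and> card S \<le> b \<and> small_cuts (\<theta> * real b) Ms S}"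
    then obtain S where S: "S \<subseteq> L \<union> R" "\<epsilon> * real b < real (card S)" "card S \<le> b"
      "small_cuts (\<theta> * real b) Ms S" by blast
    obtain M1 M2 N where eq: "Ms = (M1, M2, N)" by (cases Ms)
    have M: "M1 \<in> perfect_matchings L R" "M2 \<in> perfect_matchings L R"
        "N \<in> perfect_matchings (L - P) (R - P)"
      using Ms(1) unfolding eq set_triple_pmf by auto
    have fS: "finite S" using S(1) fin finite_subset by blast
    have ge: "t (card S) \<le> card (inner_edges M S)"
      if "M \<in> perfect_matchings A B" "finite A" "finite B" "A \<inter> B = {}" "S - (A \<union> B) \<subseteq> P"
        "real (card (cut_edges M S)) \<le> \<theta> * real b" for M A B
    proof -
      have "real (card S) \<le> 2 * real p + \<theta> * real b + 2 * real (card (inner_edges M S))"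
        using inner_edges_ge_of_small_cut[OF that(1-4) fS that(5,6)] .
      then have "real (card S) - 2 * real (card (inner_edges M S)) \<le> 2 * \<theta> * real b" using p by linarith
      then have "int (card S) - 2 * int (card (inner_edges M S)) \<le> \<lfloor>2 * \<theta> * real b\<rfloor>"
        by (simp add: le_floor_iff)
      then have "card S \<le> y + 2 * card (inner_edges M S)" unfolding y_def by linarith
      then show ?thesis unfolding t_def by linarith
    qed
    have "all_inner_ge (t (card S)) Ms S"
      unfolding eq all_inner_ge_def prod.case
      using S(1,4) M fin disj unfolding eq small_cuts_def prod.case
      by (intro conjI ge[of M1 L R] ge[of M2 L R] ge[of N "L - P" "R - P"]) auto
    moreover have "2 * t (card S) \<le> card S" unfolding t_def by linarith
    ultimately show "\<exists>k\<in>K. Ms \<in> {Ms. \<exists>S\<subseteq>L \<union> R. card S = 2 * t k + (k - 2 * t k) \<and> all_inner_ge (t k) Ms S}"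
      using S unfolding K_def by (intro bexI[of _ "card S"]) auto
  qed
  also have "\<dots> \<le> (\<Sum>k\<in>K. exp (- (\<epsilon> / 8 * ln (3 / 2)) * real b))"
  proof (rule sum_mono)
    fix k assume "k \<in> K"
    then have k: "\<epsilon> * real b < real k" "k \<le> b" unfolding K_def by auto
    define r where "r = k - 2 * t k"
    have ky: "y < k" using k \<epsilon>b y b by linarith
    have tk: "2 * t k + r = k" "k - y \<le> 2 * t k + 1" "2 * t k \<le> k" unfolding r_def t_def by linarith+
    have "r \<le> y + 1" using tk ky by linarith
    \<comment> \<open>The \<open>+ 1\<close> comes from rounding in \<open>t\<close> and is absorbed
      by \<open>1 \<le> \<theta> * b\<close>; this turns \<open>2 * \<theta>\<close> into
      \<open>3 * \<theta>\<close>, and the fourth power of the binomial makes it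
      \<open>12 * \<theta>\<close>.\<close>
    then have r: "real r \<le> 3 * \<theta> * real b" using y b by linarith
    have "real k - real y \<le> 2 * real (t k) + 1" using tk(2) ky by linarith
    then have t4: "\<epsilon> / 4 * real b \<le> real (t k)" using k(1) y b \<epsilon>b by linarith
    have tpos: "0 < t k" using t4 \<epsilon>b b by (cases "t k") auto
    \<comment> \<open>From \<open>2 * t k \<le> k \<le> b\<close> and \<open>4 * p \<le> b\<close>:
      \<open>t k\<close> is at most \<open>b / 2\<close> while \<open>b - p\<close> is at least
      \<open>3 * b / 4\<close>. This ratio is the source of \<open>3 / 2\<close>.\<close>
    have tb: "3 * t k \<le> 2 * (b - p)" "t k \<le> b - p" using tk(3) k(2) p(2) by linarith+
    have "measure_pmf.prob triple_pmf
        {Ms. \<exists>S\<subseteq>L \<union> R. card S = 2 * t k + (k - 2 * t k) \<and> all_inner_ge (t k) Ms S}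
      \<le> real (2 * b choose r) ^ 4 / real ((b - p) choose t k)"
      using prob_exists_all_inner_ge[of "t k" r] tk(1) k(2) unfolding r_def by simp
    also have "\<dots> \<le> exp (\<epsilon> / 8 * ln (3 / 2) * real b) / exp (\<epsilon> / 4 * ln (3 / 2) * real b)"
    proof (rule frac_le)
      have "real (2 * b choose r) ^ 4 \<le> exp (3 * \<theta> * real b * (1 + ln (2 / (3 * \<theta>)))) ^ 4"
        using \<theta> r by (intro power_mono binomial_le_exp) auto
      also have "\<dots> = exp (12 * \<theta> * (1 + ln (2 / (3 * \<theta>))) * real b)"
        by (simp flip: exp_of_nat_mult add: mult_ac)
      also have "\<dots> \<le> exp (\<epsilon> / 8 * ln (3 / 2) * real b)"
        using mult_right_mono[OF \<theta>(4), of "real b"] by simp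
      finally show "real (2 * b choose r) ^ 4 \<le> exp (\<epsilon> / 8 * ln (3 / 2) * real b)" .
      have "exp (\<epsilon> / 4 * ln (3 / 2) * real b) = exp (\<epsilon> / 4 * real b * ln (3 / 2))" by (simp add: mult_ac)
      also have "\<dots> \<le> exp (real (t k) * ln (3 / 2))" using t4 by simp
      also have "\<dots> = (3 / 2) ^ t k" by (simp add: exp_of_nat_mult)
      also have "\<dots> \<le> (real (b - p) / real (t k)) ^ t k"
      proof (rule power_mono)
        have "3 * real (t k) \<le> 2 * real (b - p)" using tb(1) by linarith
        then show "3 / 2 \<le> real (b - p) / real (t k)" using tpos by (simp add: field_simps)
      qed simp
      also have "\<dots> \<le> real ((b - p) choose t k)" using tb(2) by (rule binomial_ge_n_over_k_pow_k)
      finally show "exp (\<epsilon> / 4 * ln (3 / 2) * real b) \<le> real ((b - p) choose t k)" .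
    qed auto
    also have "\<dots> = exp (- (\<epsilon> / 8 * ln (3 / 2)) * real b)"
      by (simp add: algebra_simps flip: exp_diff)
    finally show "measure_pmf.prob triple_pmf
        {Ms. \<exists>S\<subseteq>L \<union> R. card S = 2 * t k + (k - 2 * t k) \<and> all_inner_ge (t k) Ms S}
      \<le> exp (- (\<epsilon> / 8 * ln (3 / 2)) * real b)" .
  qed
  also have "\<dots> \<le> (real b + 1) * exp (- (\<epsilon> / 8 * ln (3 / 2)) * real b)"
  proof -
    have "card K \<le> card {..b}" unfolding K_def by (intro card_mono) auto
    then have "real (card K) \<le> real b + 1" by simp
    then show ?thesis by (simp add: mult_right_mono)
  qed
  finally show ?thesis .
qed

end

section \<open>Edge expansion with ports\<close>

lemma cut_edges_mono:
  assumes "E \<subseteq> F" "finite F"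
  shows "card (cut_edges E S) \<le> card (cut_edges F S)"
  using assms by (intro card_mono) (auto simp: cut_edges_def)

context port_split
begin

text \<open>The degree sum is the number of edges touching \<open>S\<close>, all of which lie inside
  \<open>T\<close>, plus the number of edges inside \<open>S\<close>, which were counted once too
  few.\<close>

lemma card_touching_le_inner_edges:
  assumes M: "M \<in> perfect_matchings A B" and AB: "finite A" "finite B" "A \<inter> B = {}"
    and T: "S \<subseteq> T" "\<And>e. e \<in> cut_edges M S \<Longrightarrow> e \<subseteq> T"
  shows "card (S \<inter> (A \<union> B)) \<le> card (inner_edges M S) + card (inner_edges M T)"
proof -
  have fM: "finite M" using finite_perfect_matching[OF M AB(1,2)] .
  have "card (S \<inter> (A \<union> B)) = card (cut_edges M S) + 2 * card (inner_edges M S)"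
    using card_perfect_matching_edges[OF M AB] .
  moreover have "card (cut_edges M S \<union> inner_edges M S) \<le> card (inner_edges M T)"
    using T fM by (intro card_mono) (auto simp: inner_edges_def cut_edges_def)
  moreover have "card (cut_edges M S \<union> inner_edges M S) = card (cut_edges M S) + card (inner_edges M S)"
    using fM by (intro card_Un_disjoint) (auto simp: inner_edges_def cut_edges_def)
  ultimately show ?thesis by linarith
qed

text \<open>
  Writing \<open>W\<close> for the outer neighbours of \<open>S\<close>, every edge touching \<open>S\<close> lies inside \<open>S \<union> W\<close>, so the edges
  spanned by \<open>S\<close> and by \<open>S \<union> W\<close> together number at least the degree sum \<open>3 |S - P| + 2 |S \<inter> P|\<close>.
  Counting \<open>W\<close> rather than edges also deals with parallel edges.
\<close>

lemma small_set_expansion: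
  assumes Ms: "(M1, M2, N) \<in> set_pmf triple_pmf" and S: "S \<subseteq> L \<union> R" "S \<noteq> {}"
    and small: "4 * real (card S) \<le> \<epsilon> * real b"
    and nc: "\<And>S. S \<subseteq> L \<union> R \<Longrightarrow> S \<noteq> {} \<Longrightarrow> real (card S) \<le> \<epsilon> * real b \<Longrightarrow> \<not> crowded (M1, M2, N) S"
  shows "real (card (S \<inter> P)) + real (card S) / 9 \<le> real (card (cut_edges (M1 \<union> M2 \<union> N) S))"
proof -
  have M: "M1 \<in> perfect_matchings L R" "M2 \<in> perfect_matchings L R"
      "N \<in> perfect_matchings (L - P) (R - P)"
    using Ms unfolding set_triple_pmf by auto
  have dP: "(L - P) \<inter> (R - P) = {}" "finite (L - P)" "finite (R - P)" using disj fin by auto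
  have finM: "finite M1" "finite M2" "finite N" using finite_perfect_matching M fin dP by blast+
  have fS: "finite S" using S(1) fin finite_subset by blast
  define F where "F = cut_edges (M1 \<union> M2 \<union> N) S"
  define W where "W = (\<Union>e\<in>F. e - S)"
  have F_eq: "F = cut_edges M1 S \<union> cut_edges M2 S \<union> cut_edges N S" unfolding F_def cut_edges_def by auto
  have finF: "finite F" using finM unfolding F_def cut_edges_def by auto
  have edge: "\<exists>u\<in>L \<union> R. \<exists>v\<in>L \<union> R. e = {u, v}" if "e \<in> M1 \<union> M2 \<union> N" for e
    using that perfect_matchings_edge[OF M(1)] perfect_matchings_edge[OF M(2)]
      perfect_matchings_edge[OF M(3)] by blast
  have "card (e - S) \<le> 1" if "e \<in> F" for e
  proof -
    obtain u v where uv: "e = {u, v}" using edge \<open>e \<in> F\<close> unfolding F_def cut_edges_def by blast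
    have "u \<in> S \<or> v \<in> S" using \<open>e \<in> F\<close> uv unfolding F_def cut_edges_def by auto
    then obtain x where "e - S \<subseteq> {x}" using uv by blast
    then show ?thesis using card_mono[of "{x}" "e - S"] by simp
  qed
  then have WF: "card W \<le> card F"
    unfolding W_def using card_UN_le[OF finF, of "\<lambda>e. e - S"] sum_mono[of F "\<lambda>e. card (e - S)" "\<lambda>_. 1"]
    by simp
  have "F \<subseteq> Pow (L \<union> R)" using edge unfolding F_def cut_edges_def by blast
  then have W_sub: "W \<subseteq> L \<union> R" unfolding W_def by blast
  then have finW: "finite W" using fin finite_subset by blast
  have cut_le: "card (cut_edges M S) \<le> card S"
    if "M \<in> perfect_matchings A B" "finite A" "finite B" "A \<inter> B = {}" for M A B
    using card_perfect_matching_edges[OF that, of S] card_mono[OF fS, of "S \<inter> (A \<union> B)"] by auto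
  have "card F \<le> card (cut_edges M1 S) + card (cut_edges M2 S) + card (cut_edges N S)"
    unfolding F_eq by (meson add_mono card_Un_le le_refl order_trans)
  then have W3: "card W \<le> 3 * card S"
    using WF cut_le[OF M(1) fin disj] cut_le[OF M(2) fin disj] cut_le[OF M(3) dP(2,3,1)] by linarith
  have SW: "S \<inter> W = {}" unfolding W_def by auto
  have Sp: "card S = card (S - P) + card (S \<inter> P)"
    using card_Int_Diff[OF fS, of P] by simp
  have cSW: "card (S \<union> W) = card S + card W" using card_Un_disjoint[OF fS finW SW] .
  have cSWP: "card ((S \<union> W) - P) + card ((S \<union> W) \<inter> P) = card S + card W"
    using card_Int_Diff[of "S \<union> W" P] cSW fS finW by simp
  have "card ((S \<union> W) \<inter> P) \<ge> card (S \<inter> P)" using fS finW by (intro card_mono) auto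
  \<comment> \<open>The worst case is that all new vertices are non-ports, each of weight 1.\<close>
  then have key: "real (card ((S \<union> W) - P)) + real (card ((S \<union> W) \<inter> P)) / 4
      \<le> real (card (S - P)) + real (card (S \<inter> P)) / 4 + real (card W)"
    using cSWP Sp by linarith
  have nS: "real (inner_count (M1, M2, N) S) \<le> real (card (S - P)) + real (card (S \<inter> P)) / 4 + real (card S) / 8"
    using nc[OF S] small unfolding crowded_def by linarith
  \<comment> \<open>As \<open>card W \<le> 3 * card S\<close>, the factor 4 in \<open>small\<close>
    keeps \<open>S \<union> W\<close> in the range where sets are not crowded.\<close>
  have "real (card (S \<union> W)) \<le> \<epsilon> * real b" using cSW W3 small by linarith
  then have nSW: "real (inner_count (M1, M2, N) (S \<union> W)) \<le>
      real (card ((S \<union> W) - P)) + real (card ((S \<union> W) \<inter> P)) / 4 + real (card (S \<union> W)) / 8"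
    using nc[of "S \<union> W"] S W_sub unfolding crowded_def by (simp add: not_le)
  have cutW: "e \<subseteq> S \<union> W" if "e \<in> F" for e using that unfolding W_def by blast
  have "card (S \<inter> (L \<union> R)) \<le> card (inner_edges M1 S) + card (inner_edges M1 (S \<union> W))"
    using cutW unfolding F_eq by (intro card_touching_le_inner_edges[OF M(1) fin disj]) auto
  moreover have "card (S \<inter> (L \<union> R)) \<le> card (inner_edges M2 S) + card (inner_edges M2 (S \<union> W))"
    using cutW unfolding F_eq by (intro card_touching_le_inner_edges[OF M(2) fin disj]) auto
  moreover have "card (S \<inter> ((L - P) \<union> (R - P))) \<le> card (inner_edges N S) + card (inner_edges N (S \<union> W))"
    using cutW unfolding F_eq by (intro card_touching_le_inner_edges[OF M(3) dP(2,3,1)]) auto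
  moreover have "S \<inter> (L \<union> R) = S" "S \<inter> ((L - P) \<union> (R - P)) = S - P" using S by auto
  ultimately have "2 * card S + card (S - P)
      \<le> inner_count (M1, M2, N) S + inner_count (M1, M2, N) (S \<union> W)"
    unfolding inner_count_def by simp
  then have "2 * real (card S) + real (card (S - P))
      \<le> real (inner_count (M1, M2, N) S) + real (inner_count (M1, M2, N) (S \<union> W))"
    by linarith
  \<comment> \<open>The bounds add up to 3/4 |S| + 1/2 |S \<inter> P| \<le> 9/8 |W|, that is, 2/3 |S
    - P| + 10/9 |S \<inter> P| \<le> |W|. The surplus 1/9 is what remains when \<open>S\<close>
    consists of ports only.\<close>
  then have "real (card (S \<inter> P)) + real (card S) / 9 \<le> real (card W)"
    using nS nSW key cSW Sp by linarith
  then show ?thesis using WF unfolding F_def by linarith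
qed

text \<open>For small sets the surplus 1/9 exceeds \<open>\<theta> / 2\<close>. For large ones some
  matching has more than \<open>\<theta> * b\<close> cut edges: half of them pay for the at most
  \<open>2 * p\<close> ports, the other half for \<open>\<theta> / 2 * card S\<close>. Additional
  edges of \<open>E\<close> only enlarge cuts.\<close>

lemma port_expander_if_not_crowded:
  assumes Ms: "(M1, M2, N) \<in> set_pmf triple_pmf"
    and nc: "\<And>S. S \<subseteq> L \<union> R \<Longrightarrow> S \<noteq> {} \<Longrightarrow> real (card S) \<le> \<epsilon> * real b \<Longrightarrow> \<not> crowded (M1, M2, N) S"
    and cuts: "\<And>S. S \<subseteq> L \<union> R \<Longrightarrow> \<epsilon> / 4 * real b < real (card S) \<Longrightarrow> card S \<le> b
      \<Longrightarrow> \<not> small_cuts (\<theta> * real b) (M1, M2, N) S"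
    and p: "4 * real p \<le> \<theta> * real b" and \<theta>: "0 < \<theta>" "\<theta> \<le> 1 / 9"
    and E: "M1 \<union> M2 \<union> N \<subseteq> E" "finite E"
  shows "port_expander (L \<union> R) E P b (\<theta> / 2)"
  unfolding port_expander_def
proof (intro allI impI)
  fix S assume S: "S \<subseteq> L \<union> R" "card S \<le> b"
  consider "S = {}" | "S \<noteq> {}" "4 * real (card S) \<le> \<epsilon> * real b" | "\<epsilon> / 4 * real b < real (card S)"
    by fastforce
  then show "real (card (S \<inter> P)) + \<theta> / 2 * real (card S) \<le> real (card (cut_edges E S))"
  proof cases
    case 2
    have "real (card (S \<inter> P)) + real (card S) / 9 \<le> real (card (cut_edges (M1 \<union> M2 \<union> N) S))"
      using small_set_expansion[OF Ms S(1) 2(1,2)] nc by blast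
    also have "\<dots> \<le> real (card (cut_edges E S))" using cut_edges_mono[OF E] by simp
    finally have "real (card (S \<inter> P)) + real (card S) / 9 \<le> real (card (cut_edges E S))" .
    moreover have "\<theta> / 2 * real (card S) \<le> 1 / 9 * real (card S)"
      using \<theta> by (intro mult_right_mono) auto
    ultimately show ?thesis by linarith
  next
    case 3
    have "\<theta> * real b < real (card (cut_edges M1 S)) \<or> \<theta> * real b < real (card (cut_edges M2 S))
        \<or> \<theta> * real b < real (card (cut_edges N S))"
      using cuts[OF S(1) 3 S(2)] unfolding small_cuts_def by auto
    moreover have "card (cut_edges M1 S) \<le> card (cut_edges E S)" "card (cut_edges M2 S) \<le> card (cut_edges E S)"
      "card (cut_edges N S) \<le> card (cut_edges E S)"
      using E by (intro cut_edges_mono; blast)+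
    ultimately have "\<theta> * real b < real (card (cut_edges E S))" by linarith
    moreover have "card (S \<inter> P) \<le> 2 * p" using card_mono[OF fin_P, of "S \<inter> P"] card_P_total by simp
    moreover have "\<theta> / 2 * real (card S) \<le> \<theta> / 2 * real b"
      using S \<theta> by (intro mult_left_mono) auto
    ultimately show ?thesis using p by linarith
  qed (simp add: cut_edges_def)
qed

text \<open>Quantifying over every finite \<open>E\<close> above the triple makes this an event of
  the triple alone, whatever the other matchings add. Large sets start at
  \<open>\<epsilon> / 4 * b\<close>, where the small-set argument stops, which turns
  \<open>\<epsilon> / 8\<close> into \<open>\<epsilon> / 32\<close>.\<close>

lemma prob_port_expander:
  assumes \<epsilon>: "0 < \<epsilon>" "\<epsilon> \<le> 1 / 2" "64 * exp 8 * (2 * \<epsilon>) powr (1 / 16) \<le> 1 / 4"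
    and \<theta>: "0 < \<theta>" "6 * \<theta> \<le> \<epsilon> / 4" "12 * \<theta> * (1 + ln (2 / (3 * \<theta>))) \<le> \<epsilon> / 32 * ln (3 / 2)"
    and b: "1 \<le> \<theta> * real b" and p: "real p \<le> real b powr (1 / 4)" "4 * real p \<le> \<theta> * real b"
  shows "measure_pmf.prob triple_pmf {(M1, M2, N). \<not> (\<forall>E. M1 \<union> M2 \<union> N \<subseteq> E \<longrightarrow> finite E \<longrightarrow>
      port_expander (L \<union> R) E P b (\<theta> / 2))}
    \<le> real b powr (- 1 / 16) + (real b + 1) * exp (- (\<epsilon> / 32 * ln (3 / 2)) * real b)"
    (is "measure_pmf.prob _ ?B \<le> _")
proof -
  let ?B1 = "{Ms. \<exists>S\<subseteq>L \<union> R. S \<noteq> {} \<and> real (card S) \<le> \<epsilon> * real b \<and> crowded Ms S}"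
  let ?B2 = "{Ms. \<exists>S\<subseteq>L \<union> R. \<epsilon> / 4 * real b < real (card S) \<and> card S \<le> b \<and> small_cuts (\<theta> * real b) Ms S}"
  have \<theta>1: "\<theta> \<le> 1 / 9" using \<theta> \<epsilon> by linarith
  have "\<theta> * real b \<le> 1 * real b" using \<theta>1 by (intro mult_right_mono) auto
  then have p4: "4 * p \<le> b" using p(2) by linarith
  have b0: "0 < b" using b by (cases b) auto
  have "measure_pmf.prob triple_pmf ?B \<le> (\<Sum>i\<in>{True, False}. measure_pmf.prob triple_pmf (if i then ?B1 else ?B2))"
  proof (rule prob_le_sum)
    fix Ms assume Ms: "Ms \<in> set_pmf triple_pmf" "Ms \<in> ?B"
    obtain M1 M2 N where eq: "Ms = (M1, M2, N)" by (cases Ms)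
    have "Ms \<in> ?B1 \<or> Ms \<in> ?B2"
    proof (rule ccontr)
      assume "\<not> ?thesis"
      then have "port_expander (L \<union> R) E P b (\<theta> / 2)" if "M1 \<union> M2 \<union> N \<subseteq> E" "finite E" for E
        using Ms(1) that p \<theta> \<theta>1 unfolding eq
        by (intro port_expander_if_not_crowded[of M1 M2 N \<epsilon> \<theta>]) auto
      then show False using Ms(2) unfolding eq by auto
    qed
    then show "\<exists>i\<in>{True, False}. Ms \<in> (if i then ?B1 else ?B2)" by auto
  qed simp
  also have "\<dots> = measure_pmf.prob triple_pmf ?B1 + measure_pmf.prob triple_pmf ?B2" by simp
  also have "measure_pmf.prob triple_pmf ?B1 \<le> real b powr (- 1 / 16)"
    using b0 p p4 \<epsilon> by (intro prob_exists_crowded) auto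
  also have "measure_pmf.prob triple_pmf ?B2 \<le> (real b + 1) * exp (- (\<epsilon> / 4 / 8 * ln (3 / 2)) * real b)"
    using \<theta> \<epsilon> b p p4 by (intro prob_exists_small_cuts) auto
  finally show ?thesis by simp
qed

end

section \<open>The conditional Gibbs measure\<close>

definition nonmono_edges :: "('v \<Rightarrow> nat) \<Rightarrow> 'v set set \<Rightarrow> 'v set set" where
  "nonmono_edges \<sigma> E = {e \<in> E. \<not> (\<forall>u\<in>e. \<forall>v\<in>e. \<sigma> u = \<sigma> v)}"

text \<open>Double counting: a colour class can only cut an edge if its colour occurs at one of the
  two ends, and a cut edge is not monochromatic.\<close>

lemma sum_card_cut_color_classes_le:
  assumes E: "finite E" "\<And>e. e \<in> E \<Longrightarrow> e \<subseteq> W \<and> card e = 2"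
  shows "(\<Sum>i\<in>{1..q}. card (cut_edges E {v \<in> W. \<sigma> v = i})) \<le> 2 * card (nonmono_edges \<sigma> E)"
proof -
  let ?N = "nonmono_edges \<sigma> E" and ?S = "\<lambda>i. {v \<in> W. \<sigma> v = i}"
  have finN: "finite ?N" using E(1) by (simp add: nonmono_edges_def)
  have "cut_edges E (?S i) \<subseteq> ?N" for i
    unfolding cut_edges_def nonmono_edges_def using E(2) by fastforce
  then have "card (cut_edges E (?S i)) = (\<Sum>e\<in>?N. of_bool (e \<in> cut_edges E (?S i)))" for i
    using finN by (simp add: Int_absorb1)
  then have "(\<Sum>i\<in>{1..q}. card (cut_edges E (?S i)))
      = (\<Sum>e\<in>?N. \<Sum>i\<in>{1..q}. of_bool (e \<in> cut_edges E (?S i)))"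
    by (simp only:) (rule sum.swap)
  also have "\<dots> \<le> (\<Sum>e\<in>?N. 2)"
  proof (rule sum_mono)
    fix e assume "e \<in> ?N"
    then have e: "card e = 2" using E(2) unfolding nonmono_edges_def by blast
    then have fe: "finite e" using card.infinite by fastforce
    have "(\<Sum>i\<in>{1..q}. of_bool (e \<in> cut_edges E (?S i))) = card ({1..q} \<inter> {i. e \<in> cut_edges E (?S i)})"
      by simp
    also have "\<dots> \<le> card (\<sigma> ` e)" using fe by (intro card_mono) (auto simp: cut_edges_def)
    also have "\<dots> \<le> 2" using card_image_le[OF fe, of \<sigma>] e by simp
    finally show "(\<Sum>i\<in>{1..q}. of_bool (e \<in> cut_edges E (?S i))) \<le> (2 :: nat)" .
  qed
  finally show ?thesis by simp
qed

text \<open>If some colour has at least half of the vertices, expansion is applied to the complement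
  of its class. Otherwise every class is small enough for expansion itself, and any colour will
  do.\<close>

lemma port_expander_coloring:
  assumes W: "finite W" "card W = 2 * b" and P: "P \<subseteq> W" "card P = 2 * p"
    and E: "finite E" "\<And>e. e \<in> E \<Longrightarrow> e \<subseteq> W \<and> card e = 2"
    and exp: "port_expander W E P b c" and c: "0 < c" "2 * real p \<le> c * real b"
    and \<sigma>: "\<And>v. v \<in> W \<Longrightarrow> \<sigma> v \<in> {1..q}" and q: "1 \<le> q"
  shows "\<exists>i\<in>{1..q}. real (card {v \<in> P. \<sigma> v \<noteq> i}) + c / 4 * real (card {v \<in> W. \<sigma> v \<noteq> i})
    \<le> real (card (nonmono_edges \<sigma> E))"
proof (cases "\<exists>i\<in>{1..q}. card {v \<in> W. \<sigma> v \<noteq> i} \<le> b")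
  case True
  then obtain i where i: "i \<in> {1..q}" "card {v \<in> W. \<sigma> v \<noteq> i} \<le> b" by blast
  let ?S = "{v \<in> W. \<sigma> v \<noteq> i}"
  have SP: "?S \<inter> P = {v \<in> P. \<sigma> v \<noteq> i}" using P by blast
  have "real (card (?S \<inter> P)) + c * real (card ?S) \<le> real (card (cut_edges E ?S))"
    using i(2) by (intro exp[unfolded port_expander_def, rule_format]) auto
  also have "card (cut_edges E ?S) \<le> card (nonmono_edges \<sigma> E)"
  proof (intro card_mono subsetI)
    show "finite (nonmono_edges \<sigma> E)" using E(1) by (simp add: nonmono_edges_def)
    fix e assume "e \<in> cut_edges E ?S"
    then obtain u v where e: "e \<in> E" "u \<in> e" "u \<in> ?S" "v \<in> e" "v \<notin> ?S"
      unfolding cut_edges_def by blast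
    then have "\<sigma> u \<noteq> \<sigma> v" using E(2)[OF e(1)] by auto
    then show "e \<in> nonmono_edges \<sigma> E" using e unfolding nonmono_edges_def by blast
  qed
  finally have "real (card (?S \<inter> P)) + c * real (card ?S) \<le> real (card (nonmono_edges \<sigma> E))" by simp
  moreover have "c / 4 * real (card ?S) \<le> c * real (card ?S)" using c by (intro mult_right_mono) auto
  ultimately show ?thesis using i(1) unfolding SP by (intro bexI[of _ i]) auto
next
  case False
  let ?S = "\<lambda>i. {v \<in> W. \<sigma> v = i}"
  have finP: "finite P" using P W finite_subset by blast
  have "real (card {v \<in> P. \<sigma> v = i}) + c * real (card (?S i)) \<le> real (card (cut_edges E (?S i)))"
    if i: "i \<in> {1..q}" for i
  proof -
    have "card W = card (?S i) + card {v \<in> W. \<sigma> v \<noteq> i}"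
      using card_Int_Diff[OF W(1), of "{v. \<sigma> v = i}"] by (simp add: Int_def set_diff_eq)
    moreover have "b < card {v \<in> W. \<sigma> v \<noteq> i}" using False i not_le by blast
    ultimately have "card (?S i) \<le> b" using W(2) by linarith
    then have "real (card (?S i \<inter> P)) + c * real (card (?S i)) \<le> real (card (cut_edges E (?S i)))"
      by (intro exp[unfolded port_expander_def, rule_format]) auto
    moreover have "?S i \<inter> P = {v \<in> P. \<sigma> v = i}" using P by blast
    ultimately show ?thesis by simp
  qed
  then have "(\<Sum>i\<in>{1..q}. real (card {v \<in> P. \<sigma> v = i}) + c * real (card (?S i)))
      \<le> (\<Sum>i\<in>{1..q}. real (card (cut_edges E (?S i))))" by (rule sum_mono)
  also have "\<dots> \<le> 2 * real (card (nonmono_edges \<sigma> E))"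
    using sum_card_cut_color_classes_le[OF E, of \<sigma> q]
    by (simp flip: of_nat_sum)
  also have "(\<Sum>i\<in>{1..q}. real (card {v \<in> P. \<sigma> v = i}) + c * real (card (?S i)))
      = real (\<Sum>i\<in>{1..q}. card {v \<in> P. \<sigma> v = i}) + c * real (\<Sum>i\<in>{1..q}. card (?S i))"
    by (simp add: sum.distrib sum_distrib_left)
  also have "(\<Sum>i\<in>{1..q}. card (?S i)) = card W"
    using sum.group[OF W(1) finite_atLeastAtMost, of \<sigma> 1 q "\<lambda>_. 1 :: nat"] \<sigma> by (simp add: image_subset_iff)
  also have "(\<Sum>i\<in>{1..q}. card {v \<in> P. \<sigma> v = i}) = card P"
    using sum.group[OF finP finite_atLeastAtMost, of \<sigma> 1 q "\<lambda>_. 1 :: nat"] \<sigma>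
      subsetD[OF P(1)] by (simp add: image_subset_iff)
  \<comment> \<open>Each class contributes its cut, and every edge is counted at most twice, so half
    of \<open>card P + c * card W\<close> is available. Recolouring everything needs at most
    \<open>2 * p + c * b / 2\<close>, which fits because \<open>2 * p \<le> c * b\<close>. Only this
    case needs \<open>c / 4\<close> in place of \<open>c\<close>.\<close>
  finally have "real p + c * real b \<le> real (card (nonmono_edges \<sigma> E))" using W P by simp
  moreover have "card {v \<in> P. \<sigma> v \<noteq> 1} \<le> 2 * p" using card_mono[OF finP, of "{v \<in> P. \<sigma> v \<noteq> 1}"] P by auto
  moreover have "c / 4 * real (card {v \<in> W. \<sigma> v \<noteq> 1}) \<le> c / 4 * real (2 * b)"
    using card_mono[OF W(1), of "{v \<in> W. \<sigma> v \<noteq> 1}"] W c by (intro mult_left_mono) auto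
  moreover have "c / 4 * real (2 * b) = c * real b / 2" by simp
  ultimately have "real (card {v \<in> P. \<sigma> v \<noteq> 1}) + c / 4 * real (card {v \<in> W. \<sigma> v \<noteq> 1})
    \<le> real (card (nonmono_edges \<sigma> E))" using c by linarith
  then show ?thesis using q by (intro bexI[of _ 1]) auto
qed

lemma port_extension_finite_edges:
  assumes "port_extension W E\<^sub>B P 1 V E"
  shows "finite V" "finite E" "E\<^sub>B \<subseteq> E" "\<And>e. e \<in> E \<Longrightarrow> e \<subseteq> V \<and> card e = 2"
proof -
  show V: "finite V" and E: "\<And>e. e \<in> E \<Longrightarrow> e \<subseteq> V \<and> card e = 2" and "E\<^sub>B \<subseteq> E"
    using assms unfolding port_extension_def simple_graph_def by auto
  have "E \<subseteq> Pow V" using E by blast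
  then show "finite E" using V finite_subset by blast
qed

text \<open>As the block is an induced subgraph, an edge outside \<open>E\<^sub>B\<close> that meets
  it has its other end outside. Such edges start only at ports, at most one at each.\<close>

lemma card_outer_edges_le:
  assumes ext: "port_extension W E\<^sub>B P 1 V E" and Q: "finite W" "Q \<subseteq> W"
  shows "card {e \<in> E - E\<^sub>B. e \<inter> Q \<noteq> {}} \<le> card (Q \<inter> P)"
proof -
  note fe = port_extension_finite_edges[OF ext]
  have inner: "{e \<in> E. e \<subseteq> W} = E\<^sub>B"
    and one: "\<And>u. u \<in> P \<Longrightarrow> card {w \<in> V - W. {u, w} \<in> E} \<le> 1"
    and none: "\<And>u w. u \<in> W - P \<Longrightarrow> w \<in> V - W \<Longrightarrow> {u, w} \<notin> E"
    using ext unfolding port_extension_def by auto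
  have finQ: "finite (Q \<inter> P)" using Q finite_subset by blast
  have "{e \<in> E - E\<^sub>B. e \<inter> Q \<noteq> {}} \<subseteq> (\<Union>u\<in>Q \<inter> P. (\<lambda>w. {u, w}) ` {w \<in> V - W. {u, w} \<in> E})"
  proof
    fix e assume "e \<in> {e \<in> E - E\<^sub>B. e \<inter> Q \<noteq> {}}"
    then obtain u where e: "e \<in> E" "\<not> e \<subseteq> W" and u: "u \<in> e" "u \<in> Q" using inner by blast
    obtain w where w: "e = {u, w}"
      using fe(4)[OF e(1)] u(1) by (auto simp: card_2_iff)
    have wV: "w \<in> V - W" using fe(4)[OF e(1)] e(2) u Q w by auto
    have "u \<in> P" using none[OF _ wV, of u] e(1) w u Q by blast
    then show "e \<in> (\<Union>u\<in>Q \<inter> P. (\<lambda>w. {u, w}) ` {w \<in> V - W. {u, w} \<in> E})"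
      using u w wV e(1) by blast
  qed
  then have "card {e \<in> E - E\<^sub>B. e \<inter> Q \<noteq> {}} \<le> card (\<Union>u\<in>Q \<inter> P. (\<lambda>w. {u, w}) ` {w \<in> V - W. {u, w} \<in> E})"
    using finQ fe(1) by (intro card_mono) auto
  also have "\<dots> \<le> (\<Sum>u\<in>Q \<inter> P. card ((\<lambda>w. {u, w}) ` {w \<in> V - W. {u, w} \<in> E}))"
    using finQ by (rule card_UN_le)
  also have "\<dots> \<le> (\<Sum>u\<in>Q \<inter> P. 1)"
  proof (rule sum_mono)
    fix u assume "u \<in> Q \<inter> P"
    then have "card {w \<in> V - W. {u, w} \<in> E} \<le> 1" using one by blast
    moreover have "card ((\<lambda>w. {u, w}) ` {w \<in> V - W. {u, w} \<in> E}) \<le> card {w \<in> V - W. {u, w} \<in> E}"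
      using fe(1) by (intro card_image_le) auto
    ultimately show "card ((\<lambda>w. {u, w}) ` {w \<in> V - W. {u, w} \<in> E}) \<le> 1" by linarith
  qed
  finally show ?thesis by simp
qed

text \<open>Recolouring gains \<open>\<beta>\<^sub>B\<close> on each edge of
  \<open>E\<^sub>B\<close> that was not monochromatic. It loses at most
  \<open>\<beta>\<^sub>B\<close> on each outer edge at a recoloured port, whatever the sign of the
  coupling, and at most \<open>\<bar>h\<bar>\<close> at each recoloured vertex. The port term in
  \<open>exp\<close> cancels the outer loss.\<close>

lemma potts_weight_le:
  fixes h :: real and \<kappa> :: nat
  assumes ext: "port_extension W E\<^sub>B P 1 V E" and W: "finite W" "P \<subseteq> W"
    and \<beta>: "\<beta>\<^sub>B > 0" "\<And>e. e \<in> E\<^sub>B \<Longrightarrow> \<beta> e = \<beta>\<^sub>B" "\<And>e. e \<in> E - E\<^sub>B \<Longrightarrow> \<bar>\<beta> e\<bar> \<le> \<beta>\<^sub>B"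
    and \<sigma>i: "\<And>v. v \<in> W \<Longrightarrow> \<sigma>i v = i" "\<And>v. v \<in> V - W \<Longrightarrow> \<sigma>i v = \<sigma> v"
    and exp: "real (card {v \<in> P. \<sigma> v \<noteq> i}) + c * real (card {v \<in> W. \<sigma> v \<noteq> i})
      \<le> real (card (nonmono_edges \<sigma> E\<^sub>B))"
  defines "H \<equiv> \<lambda>v j. h * of_bool (j = \<kappa>) * of_bool (v \<in> W)"
  shows "potts_weight V E \<beta> H \<sigma> \<le>
    potts_weight V E \<beta> H \<sigma>i * exp (\<bar>h\<bar> - c * \<beta>\<^sub>B) ^ card {v \<in> W. \<sigma> v \<noteq> i}"
proof -
  note fe = port_extension_finite_edges[OF ext]
  let ?m = "\<lambda>\<rho> e. of_bool (\<forall>u\<in>e. \<forall>v\<in>e. \<rho> u = \<rho> v) :: real"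
  let ?Q = "{v \<in> W. \<sigma> v \<noteq> i}"
  let ?k = "real (card ?Q)" and ?s = "real (card {v \<in> P. \<sigma> v \<noteq> i})"
  have inner: "{e \<in> E. e \<subseteq> W} = E\<^sub>B" and WV: "W \<subseteq> V"
    using ext unfolding port_extension_def by auto
  have finB: "finite E\<^sub>B" using fe finite_subset by blast
  have split: "(\<Sum>e\<in>E. \<beta> e * ?m \<rho> e) = (\<Sum>e\<in>E\<^sub>B. \<beta> e * ?m \<rho> e) + (\<Sum>e\<in>E - E\<^sub>B. \<beta> e * ?m \<rho> e)" for \<rho>
    using sum.subset_diff[OF fe(3,2)] by (metis (no_types) add.commute)
  have "(\<Sum>e\<in>E\<^sub>B. \<beta> e * ?m \<sigma> e) - (\<Sum>e\<in>E\<^sub>B. \<beta> e * ?m \<sigma>i e)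
      = (\<Sum>e\<in>E\<^sub>B. - \<beta>\<^sub>B * of_bool (e \<in> nonmono_edges \<sigma> E\<^sub>B))"
    unfolding sum_subtractf[symmetric]
  proof (rule sum.cong[OF refl])
    fix e assume e: "e \<in> E\<^sub>B"
    then have "e \<subseteq> W" using inner by blast
    then have "\<sigma>i v = i" if "v \<in> e" for v using \<sigma>i(1) that by blast
    then have m1: "?m \<sigma>i e = 1" by simp
    have nm: "e \<in> nonmono_edges \<sigma> E\<^sub>B \<longleftrightarrow> \<not> (\<forall>u\<in>e. \<forall>v\<in>e. \<sigma> u = \<sigma> v)"
      using e by (simp only: nonmono_edges_def mem_Collect_eq simp_thms)
    have bool: "x * of_bool m - x * 1 = - x * of_bool (\<not> m)" for x :: real and m by (cases m) auto
    show "\<beta> e * ?m \<sigma> e - \<beta> e * ?m \<sigma>i e = - \<beta>\<^sub>B * of_bool (e \<in> nonmono_edges \<sigma> E\<^sub>B)"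
      unfolding m1 \<beta>(2)[OF e] nm by (rule bool)
  qed
  also have "\<dots> = - \<beta>\<^sub>B * real (card (nonmono_edges \<sigma> E\<^sub>B))"
  proof -
    have "E\<^sub>B \<inter> nonmono_edges \<sigma> E\<^sub>B = nonmono_edges \<sigma> E\<^sub>B" unfolding nonmono_edges_def by blast
    then show ?thesis using finB unfolding sum_distrib_left[symmetric] by simp
  qed
  finally have B1: "(\<Sum>e\<in>E\<^sub>B. \<beta> e * ?m \<sigma> e) - (\<Sum>e\<in>E\<^sub>B. \<beta> e * ?m \<sigma>i e)
      = - \<beta>\<^sub>B * real (card (nonmono_edges \<sigma> E\<^sub>B))" .
  have "(\<Sum>e\<in>E - E\<^sub>B. \<beta> e * ?m \<sigma> e) - (\<Sum>e\<in>E - E\<^sub>B. \<beta> e * ?m \<sigma>i e)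
      \<le> (\<Sum>e\<in>E - E\<^sub>B. \<beta>\<^sub>B * of_bool (e \<inter> ?Q \<noteq> {}))"
    unfolding sum_subtractf[symmetric]
  proof (rule sum_mono)
    fix e assume e: "e \<in> E - E\<^sub>B"
    show "\<beta> e * ?m \<sigma> e - \<beta> e * ?m \<sigma>i e \<le> \<beta>\<^sub>B * of_bool (e \<inter> ?Q \<noteq> {})"
    proof (cases "e \<inter> ?Q = {}")
      case True
      have "e \<subseteq> V" using fe(4) e by blast
      have "\<sigma>i v = \<sigma> v" if "v \<in> e" for v
        using \<open>e \<subseteq> V\<close> True that \<sigma>i by (cases "v \<in> W") auto
      then have "?m \<sigma>i e = ?m \<sigma> e" by auto
      then show ?thesis using True by simp
    next
      case False
      have "\<bar>\<beta> e\<bar> \<le> \<beta>\<^sub>B" using \<beta>(3) e by blast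
      moreover have "x * of_bool m - x * of_bool m' \<le> \<bar>x\<bar>" for x :: real and m m'
        by (cases m; cases m') auto
      ultimately have "\<beta> e * ?m \<sigma> e - \<beta> e * ?m \<sigma>i e \<le> \<beta>\<^sub>B" by (rule order_trans[rotated])
      then show ?thesis using False by (simp only: of_bool_eq) simp
    qed
  qed
  also have "\<dots> = \<beta>\<^sub>B * real (card {e \<in> E - E\<^sub>B. e \<inter> ?Q \<noteq> {}})"
    using fe(2) by (simp add: Int_def flip: sum_distrib_left)
  also have "\<dots> \<le> \<beta>\<^sub>B * ?s"
  proof -
    have "?Q \<inter> P = {v \<in> P. \<sigma> v \<noteq> i}" using W by blast
    then show ?thesis using card_outer_edges_le[OF ext W(1), of ?Q] \<beta>(1) by simp
  qed
  finally have B2: "(\<Sum>e\<in>E - E\<^sub>B. \<beta> e * ?m \<sigma> e) - (\<Sum>e\<in>E - E\<^sub>B. \<beta> e * ?m \<sigma>i e) \<le> \<beta>\<^sub>B * ?s" .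
  have "(\<Sum>v\<in>V. H v (\<sigma> v)) - (\<Sum>v\<in>V. H v (\<sigma>i v)) \<le> (\<Sum>v\<in>V. \<bar>h\<bar> * of_bool (v \<in> ?Q))"
    unfolding sum_subtractf[symmetric]
  proof (rule sum_mono)
    fix v assume "v \<in> V"
    show "H v (\<sigma> v) - H v (\<sigma>i v) \<le> \<bar>h\<bar> * of_bool (v \<in> ?Q)"
      unfolding H_def using \<sigma>i(1)[of v] by (auto simp: of_bool_def)
  qed
  also have "\<dots> = \<bar>h\<bar> * ?k"
  proof -
    have "V \<inter> ?Q = ?Q" using WV by blast
    then show ?thesis using fe(1) by (simp add: Int_def flip: sum_distrib_left)
  qed
  finally have B3: "(\<Sum>v\<in>V. H v (\<sigma> v)) - (\<Sum>v\<in>V. H v (\<sigma>i v)) \<le> \<bar>h\<bar> * ?k" .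
  have "\<beta>\<^sub>B * (?s + c * ?k) \<le> \<beta>\<^sub>B * real (card (nonmono_edges \<sigma> E\<^sub>B))"
    using exp \<beta>(1) by (intro mult_left_mono) auto
  then have "(\<Sum>e\<in>E. \<beta> e * ?m \<sigma> e) + (\<Sum>v\<in>V. H v (\<sigma> v))
      \<le> (\<Sum>e\<in>E. \<beta> e * ?m \<sigma>i e) + (\<Sum>v\<in>V. H v (\<sigma>i v)) + ?k * (\<bar>h\<bar> - c * \<beta>\<^sub>B)"
    using B1 B2 B3 unfolding split by (simp add: algebra_simps)
  then show ?thesis
    unfolding potts_weight_def by (simp flip: exp_add exp_of_nat_mult)
qed

text \<open>With the colours outside \<open>W\<close> fixed, a configuration is its restriction to
  \<open>W\<close>, and the weight factors over the vertices: 1 for the colour \<open>i\<close> and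
  \<open>y\<close> for each of the \<open>q - 1\<close> others.\<close>

lemma sum_configs_power_le:
  fixes y :: real
  assumes W: "finite W" "W \<subseteq> V" and V: "finite V" and i: "i \<in> {1..q}" and y: "0 \<le> y"
  shows "(\<Sum>\<sigma> | \<sigma> \<in> configs V q \<and> (\<forall>v\<in>V - W. \<sigma> v = \<tau> v). y ^ card {v \<in> W. \<sigma> v \<noteq> i})
    \<le> (1 + (real q - 1) * y) ^ card W"
proof -
  let ?f = "\<lambda>j. if j = i then 1 else y"
  let ?C = "{\<sigma> \<in> configs V q. \<forall>v\<in>V - W. \<sigma> v = \<tau> v}"
  have "(\<Sum>\<sigma>\<in>?C. y ^ card {v \<in> W. \<sigma> v \<noteq> i}) = (\<Sum>\<sigma>\<in>?C. \<Prod>v\<in>W. ?f (restrict \<sigma> W v))"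
  proof (rule sum.cong[OF refl])
    fix \<sigma> :: "'a \<Rightarrow> nat"
    have "(\<Prod>v\<in>W. ?f (restrict \<sigma> W v)) = (\<Prod>v\<in>W. if \<sigma> v \<noteq> i then y else 1)"
      by (rule prod.cong) auto
    also have "\<dots> = (\<Prod>v\<in>{v \<in> W. \<sigma> v \<noteq> i}. y)" using W(1) by (subst prod.inter_filter) auto
    finally show "y ^ card {v \<in> W. \<sigma> v \<noteq> i} = (\<Prod>v\<in>W. ?f (restrict \<sigma> W v))" by simp
  qed
  also have "\<dots> = (\<Sum>\<rho>\<in>(\<lambda>\<sigma>. restrict \<sigma> W) ` ?C. \<Prod>v\<in>W. ?f (\<rho> v))"
  proof (rule sum.reindex[unfolded comp_def, symmetric])
    show "inj_on (\<lambda>\<sigma>. restrict \<sigma> W) ?C"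
    proof (rule inj_onI)
      fix \<sigma> \<rho> assume C: "\<sigma> \<in> ?C" "\<rho> \<in> ?C" and eq: "restrict \<sigma> W = restrict \<rho> W"
      show "\<sigma> = \<rho>"
      proof (rule ext)
        fix v
        consider "v \<in> W" | "v \<in> V - W" | "v \<notin> V" using W by blast
        then show "\<sigma> v = \<rho> v"
        proof cases
          case 1
          then show ?thesis using eq by (metis restrict_apply')
        next
          case 2
          then show ?thesis using C by simp
        next
          case 3
          then have "\<sigma> v = undefined" "\<rho> v = undefined"
            using C unfolding configs_def by (blast intro: PiE_arb)+
          then show ?thesis by simp
        qed
      qed
    qed
  qed
  \<comment> \<open>Only an inequality, because \<open>\<tau>\<close> is arbitrary and may not
    extend to any configuration.\<close>
  also have "\<dots> \<le> (\<Sum>\<rho>\<in>W \<rightarrow>\<^sub>E {1..q}. \<Prod>v\<in>W. ?f (\<rho> v))"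
    using W y by (intro sum_mono2 finite_PiE) (auto simp: configs_def PiE_iff intro!: prod_nonneg)
  also have "\<dots> = (\<Prod>v\<in>W. \<Sum>j\<in>{1..q}. ?f j)"
    using W(1) by (intro prod_sum_PiE[symmetric]) auto
  also have "(\<Sum>j\<in>{1..q}. ?f j) = 1 + (real q - 1) * y"
  proof -
    have "(\<Sum>j\<in>{1..q}. ?f j) = ?f i + (\<Sum>j\<in>{1..q} - {i}. ?f j)"
      using i by (intro sum.remove) auto
    also have "(\<Sum>j\<in>{1..q} - {i}. ?f j) = (\<Sum>j\<in>{1..q} - {i}. y)" by (rule sum.cong) auto
    also have "\<dots> = (real q - 1) * y" using i by (simp add: of_nat_diff)
    finally show ?thesis by simp
  qed
  finally show ?thesis by simp
qed

lemma potts_cond_prob_eq: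
  assumes V: "finite V" and q: "1 \<le> q"
  shows "\<P>(\<sigma> in potts_pmf V E \<beta> H q. A \<sigma> \<bar> B \<sigma>) =
    (\<Sum>\<sigma> | \<sigma> \<in> configs V q \<and> A \<sigma> \<and> B \<sigma>. potts_weight V E \<beta> H \<sigma>)
    / (\<Sum>\<sigma> | \<sigma> \<in> configs V q \<and> B \<sigma>. potts_weight V E \<beta> H \<sigma>)"
proof -
  let ?M = "potts_pmf V E \<beta> H q" and ?Z = "potts_partition V E \<beta> H q"
  have Z: "?Z > 0" using assms by (rule potts_partition_pos)
  have pr: "measure_pmf.prob ?M {\<sigma>. Q \<sigma>} =
      (\<Sum>\<sigma> | \<sigma> \<in> configs V q \<and> Q \<sigma>. potts_weight V E \<beta> H \<sigma>) / ?Z" for Q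
  proof -
    have sub: "set_pmf ?M \<subseteq> configs V q"
      by (auto simp: set_pmf_iff pmf_potts_pmf[OF assms] split: if_splits)
    have "measure_pmf.prob ?M {\<sigma>. Q \<sigma>} = measure_pmf.prob ?M {\<sigma> \<in> configs V q. Q \<sigma>}"
      using sub by (intro measure_prob_cong_0) (auto simp: set_pmf_iff)
    also have "\<dots> = (\<Sum>\<sigma> | \<sigma> \<in> configs V q \<and> Q \<sigma>. pmf ?M \<sigma>)"
      using finite_configs[OF V] by (intro measure_measure_pmf_finite) auto
    also have "\<dots> = (\<Sum>\<sigma> | \<sigma> \<in> configs V q \<and> Q \<sigma>. potts_weight V E \<beta> H \<sigma> / ?Z)"
      by (rule sum.cong) (auto simp: pmf_potts_pmf[OF assms])
    finally show ?thesis by (simp add: sum_divide_distrib)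
  qed
  show ?thesis unfolding cond_prob_def using Z by (simp add: pr)
qed

text \<open>The total weight under the boundary condition is at most \<open>z ^ (2 * b)\<close>
  times the monochromatic weight, and \<open>1 / z\<close> is at least the stated base.\<close>

lemma potts_monochromatic_cond_prob_ge:
  assumes W: "finite W" "card W = 2 * b" "0 < b" and P: "P \<subseteq> W" "card P = 2 * p"
    and exp: "port_expander W E\<^sub>B P b c" and c: "0 < c" "2 * real p \<le> c * real b"
    and ext: "port_extension W E\<^sub>B P 1 V E"
    and \<beta>: "\<beta>\<^sub>B > 0" "\<And>e. e \<in> E\<^sub>B \<Longrightarrow> \<beta> e = \<beta>\<^sub>B" "\<And>e. e \<in> E - E\<^sub>B \<Longrightarrow> \<bar>\<beta> e\<bar> \<le> \<beta>\<^sub>B"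
    and \<kappa>: "\<kappa> \<in> {1..q}" and \<tau>: "\<tau> \<in> configs (V - W) q"
    and \<delta>: "\<delta> * d \<le> c / 4"
  shows "\<P>(\<sigma> in potts_pmf V E \<beta> (\<lambda>v i. h * of_bool (i = \<kappa>) * of_bool (v \<in> W)) q.
      (\<exists>i\<in>{1..q}. \<forall>v\<in>W. \<sigma> v = i) \<bar> \<forall>v\<in>V - W. \<sigma> v = \<tau> v)
    \<ge> (max 0 (1 - real q ^ 2 * exp (2 * \<bar>h\<bar>) / exp (\<delta> * \<beta>\<^sub>B * d))) ^ (2 * b)"
proof -
  define H where "H = (\<lambda>v i. h * of_bool (i = \<kappa>) * of_bool (v \<in> W))"
  define w where "w = potts_weight V E \<beta> H"
  define y where "y = exp (\<bar>h\<bar> - c / 4 * \<beta>\<^sub>B)"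
  define \<sigma>i where "\<sigma>i i = (\<lambda>v. if v \<in> W then i else \<tau> v)" for i
  define C where "C = {\<sigma> \<in> configs V q. \<forall>v\<in>V - W. \<sigma> v = \<tau> v}"
  define G where "G = {\<sigma> \<in> configs V q. (\<exists>i\<in>{1..q}. \<forall>v\<in>W. \<sigma> v = i) \<and> (\<forall>v\<in>V - W. \<sigma> v = \<tau> v)}"
  define z where "z = 1 + (real q - 1) * y"
  note fe = port_extension_finite_edges[OF ext]
  have q: "1 \<le> q" using \<kappa> by simp
  have y0: "0 < y" unfolding y_def by simp
  have z1: "1 \<le> z" unfolding z_def using q y0 by simp
  have inner: "{e \<in> E. e \<subseteq> W} = E\<^sub>B" and WV: "W \<subseteq> V"
    using ext unfolding port_extension_def by auto
  have EB: "finite E\<^sub>B" "\<And>e. e \<in> E\<^sub>B \<Longrightarrow> e \<subseteq> W \<and> card e = 2"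
    using fe inner finite_subset by blast+
  have w0: "0 < w \<sigma>" for \<sigma> unfolding w_def potts_weight_def by simp
  have finC: "finite C" unfolding C_def using finite_configs[OF fe(1)] by simp
  have GC: "G \<subseteq> C" unfolding G_def C_def by auto
  have \<sigma>iG: "\<sigma>i i \<in> G" if "i \<in> {1..q}" for i
    using that \<tau> WV unfolding G_def \<sigma>i_def configs_def by (auto simp: PiE_iff extensional_def)
  have W_ne: "W \<noteq> {}" using W by auto
  \<comment> \<open>Since \<open>W\<close> is nonempty, the monochromatic extensions differ, and no
    weight is counted twice when their sum is compared with that of \<open>G\<close>.\<close>
  have inj: "inj_on \<sigma>i {1..q}"
    using W_ne unfolding \<sigma>i_def by (intro inj_onI) (metis all_not_in_conv)
  \<comment> \<open>The good colour depends on \<open>\<sigma>\<close>; summing over all colours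
    removes this dependence and allows the two sums to be exchanged.\<close>
  have "w \<sigma> \<le> (\<Sum>i\<in>{1..q}. w (\<sigma>i i) * y ^ card {v \<in> W. \<sigma> v \<noteq> i})" if \<sigma>: "\<sigma> \<in> C" for \<sigma>
  proof -
    have "\<sigma> v \<in> {1..q}" if "v \<in> W" for v
      using \<sigma> that WV unfolding C_def configs_def by (auto simp: PiE_iff)
    then obtain i where i: "i \<in> {1..q}"
      "real (card {v \<in> P. \<sigma> v \<noteq> i}) + c / 4 * real (card {v \<in> W. \<sigma> v \<noteq> i})
        \<le> real (card (nonmono_edges \<sigma> E\<^sub>B))"
      using port_expander_coloring[OF W(1,2) P EB exp c _ q] by blast
    have "w \<sigma> \<le> w (\<sigma>i i) * y ^ card {v \<in> W. \<sigma> v \<noteq> i}"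
      unfolding w_def H_def y_def
    proof (rule potts_weight_le[OF ext W(1) P(1) \<beta> _ _ i(2)])
      show "\<sigma>i i v = \<sigma> v" if "v \<in> V - W" for v using that \<sigma> unfolding \<sigma>i_def C_def by auto
    qed (simp_all add: \<sigma>i_def)
    also have "\<dots> \<le> (\<Sum>i\<in>{1..q}. w (\<sigma>i i) * y ^ card {v \<in> W. \<sigma> v \<noteq> i})"
      using i(1) w0 y0 by (intro member_le_sum) (auto intro: less_imp_le)
    finally show ?thesis .
  qed
  then have "(\<Sum>\<sigma>\<in>C. w \<sigma>) \<le> (\<Sum>\<sigma>\<in>C. \<Sum>i\<in>{1..q}. w (\<sigma>i i) * y ^ card {v \<in> W. \<sigma> v \<noteq> i})"
    by (rule sum_mono)
  also have "\<dots> = (\<Sum>i\<in>{1..q}. w (\<sigma>i i) * (\<Sum>\<sigma>\<in>C. y ^ card {v \<in> W. \<sigma> v \<noteq> i}))"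
    by (subst sum.swap) (simp add: sum_distrib_left)
  also have "\<dots> \<le> (\<Sum>i\<in>{1..q}. w (\<sigma>i i) * z ^ (2 * b))"
  proof (intro sum_mono mult_left_mono)
    fix i assume "i \<in> {1..q}"
    then show "(\<Sum>\<sigma>\<in>C. y ^ card {v \<in> W. \<sigma> v \<noteq> i}) \<le> z ^ (2 * b)"
      using sum_configs_power_le[OF W(1) WV fe(1), of i q y] y0 W(2) unfolding C_def z_def by simp
  qed (use w0 in \<open>auto intro: less_imp_le\<close>)
  also have "\<dots> = (\<Sum>i\<in>{1..q}. w (\<sigma>i i)) * z ^ (2 * b)" by (simp add: sum_distrib_right)
  also have "(\<Sum>i\<in>{1..q}. w (\<sigma>i i)) = (\<Sum>\<sigma>\<in>\<sigma>i ` {1..q}. w \<sigma>)"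
    using sum.reindex[OF inj, of w] by simp
  also have "\<dots> * z ^ (2 * b) \<le> (\<Sum>\<sigma>\<in>G. w \<sigma>) * z ^ (2 * b)"
    using \<sigma>iG finC GC w0 z1
    by (intro mult_right_mono sum_mono2) (auto intro: less_imp_le finite_subset)
  finally have le: "(\<Sum>\<sigma>\<in>C. w \<sigma>) \<le> (\<Sum>\<sigma>\<in>G. w \<sigma>) * z ^ (2 * b)" .
  have Cpos: "0 < (\<Sum>\<sigma>\<in>C. w \<sigma>)"
    using finC w0 \<sigma>iG[OF \<kappa>] GC by (intro sum_pos) auto
  have "max 0 (1 - real q ^ 2 * exp (2 * \<bar>h\<bar>) / exp (\<delta> * \<beta>\<^sub>B * d)) \<le> 1 / z"
  proof -
    have "\<delta> * d * \<beta>\<^sub>B \<le> c / 4 * \<beta>\<^sub>B" using \<delta> \<beta>(1) by (intro mult_right_mono) auto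
    then have "y \<le> exp (2 * \<bar>h\<bar> - \<delta> * \<beta>\<^sub>B * d)" unfolding y_def by (simp add: mult_ac)
    moreover have "real q - 1 \<le> real q ^ 2" using q
      by (smt (verit) of_nat_1 of_nat_le_iff self_le_power zero_less_numeral)
    ultimately have "(real q - 1) * y \<le> real q ^ 2 * exp (2 * \<bar>h\<bar> - \<delta> * \<beta>\<^sub>B * d)"
      using q y0 by (intro mult_mono) auto
    then have "z - 1 \<le> real q ^ 2 * exp (2 * \<bar>h\<bar>) / exp (\<delta> * \<beta>\<^sub>B * d)"
      unfolding z_def by (simp add: exp_diff)
    moreover have "1 - (z - 1) \<le> 1 / z"
    proof -
      have "0 \<le> (z - 1)\<^sup>2" by simp
      then show ?thesis using z1 by (simp add: field_simps power2_eq_square)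
    qed
    moreover have "0 \<le> 1 / z" using z1 by simp
    ultimately show ?thesis by linarith
  qed
  then have "(max 0 (1 - real q ^ 2 * exp (2 * \<bar>h\<bar>) / exp (\<delta> * \<beta>\<^sub>B * d))) ^ (2 * b) \<le> (1 / z) ^ (2 * b)"
    by (intro power_mono) auto
  also have "\<dots> \<le> (\<Sum>\<sigma>\<in>G. w \<sigma>) / (\<Sum>\<sigma>\<in>C. w \<sigma>)"
    using le Cpos z1 by (simp add: field_simps power_one_over)
  also have "\<dots> = \<P>(\<sigma> in potts_pmf V E \<beta> H q.
      (\<exists>i\<in>{1..q}. \<forall>v\<in>W. \<sigma> v = i) \<bar> \<forall>v\<in>V - W. \<sigma> v = \<tau> v)"
    unfolding potts_cond_prob_eq[OF fe(1) q] G_def C_def w_def ..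
  finally show ?thesis unfolding H_def .
qed

section \<open>The random graph\<close>

lemma prob_bind_pmf_le:
  assumes "\<And>x. x \<in> set_pmf p \<Longrightarrow> measure_pmf.prob (f x) A \<le> c"
  shows "measure_pmf.prob (bind_pmf p f) A \<le> c"
proof -
  obtain x where "x \<in> set_pmf p" using set_pmf_not_empty[of p] by blast
  then have c: "0 \<le> c" using assms[of x] measure_nonneg order_trans by blast
  have "emeasure (bind_pmf p f) A = (\<integral>\<^sup>+x. emeasure (f x) A \<partial>p)" by simp
  also have "\<dots> \<le> (\<integral>\<^sup>+x. ennreal c \<partial>p)"
    using assms by (intro nn_integral_mono_AE)
      (auto simp: AE_measure_pmf_iff measure_pmf.emeasure_eq_measure ennreal_leI)
  also have "\<dots> = ennreal c" by simp
  finally show ?thesis using c by (simp add: measure_pmf.emeasure_eq_measure)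
qed

lemma prob_bind_pmf_le_prob:
  assumes "\<And>x y. x \<in> set_pmf p \<Longrightarrow> y \<in> set_pmf (f x) \<Longrightarrow> y \<in> A \<Longrightarrow> x \<in> B"
  shows "measure_pmf.prob (bind_pmf p f) A \<le> measure_pmf.prob p B"
proof -
  have "emeasure (bind_pmf p f) A = (\<integral>\<^sup>+x. emeasure (f x) A \<partial>p)" by simp
  also have "\<dots> \<le> (\<integral>\<^sup>+x. indicator B x \<partial>p)"
  proof (intro nn_integral_mono_AE, unfold AE_measure_pmf_iff, intro ballI)
    fix x assume x: "x \<in> set_pmf p"
    show "emeasure (f x) A \<le> indicator B x"
    proof (cases "x \<in> B")
      case True
      then show ?thesis by (simp add: measure_pmf.emeasure_le_1)
    next
      case False
      then have "set_pmf (f x) \<inter> A = {}" using assms x by blast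
      then have "measure_pmf.prob (f x) A = 0" by (simp add: measure_pmf_zero_iff)
      then show ?thesis by (simp add: measure_pmf.emeasure_eq_measure)
    qed
  qed
  also have "\<dots> = emeasure p B" by simp
  finally show ?thesis by (simp add: measure_pmf.emeasure_eq_measure)
qed

text \<open>The matchings are independent, so two of the full ones and the outer one may be drawn
  first. The other \<open>d - 3\<close> come last, where they can be disregarded.\<close>

lemma (in port_split) random_matchings_eq_bind_triple:
  assumes "3 \<le> d"
  shows "bind_pmf (replicate_pmf (d - 1) (pmf_of_set (perfect_matchings L R))) (\<lambda>Ms.
     bind_pmf (replicate_pmf 1 (pmf_of_set (perfect_matchings (L - P) (R - P)))) (\<lambda>Ns.
     return_pmf (P, \<Union>(set Ms) \<union> \<Union>(set Ns)))) =
    bind_pmf triple_pmf (\<lambda>(M1, M2, N).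
      bind_pmf (replicate_pmf (d - 3) (pmf_of_set (perfect_matchings L R))) (\<lambda>Ms.
      return_pmf (P, M1 \<union> M2 \<union> N \<union> \<Union>(set Ms))))"
proof -
  have d: "d - 1 = Suc (Suc (d - 3))" using assms by simp
  let ?q = "pmf_of_set (perfect_matchings L R)" and ?r = "pmf_of_set (perfect_matchings (L - P) (R - P))"
  have "bind_pmf (replicate_pmf (d - 1) ?q) (\<lambda>Ms. bind_pmf (replicate_pmf 1 ?r) (\<lambda>Ns.
      return_pmf (P, \<Union>(set Ms) \<union> \<Union>(set Ns)))) =
    bind_pmf ?q (\<lambda>M1. bind_pmf ?q (\<lambda>M2. bind_pmf (replicate_pmf (d - 3) ?q) (\<lambda>Ms.
      bind_pmf ?r (\<lambda>N. return_pmf (P, M1 \<union> M2 \<union> N \<union> \<Union>(set Ms))))))"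
    unfolding d by (simp add: bind_assoc_pmf bind_return_pmf Un_ac)
  also have "\<dots> = bind_pmf ?q (\<lambda>M1. bind_pmf ?q (\<lambda>M2. bind_pmf ?r (\<lambda>N.
      bind_pmf (replicate_pmf (d - 3) ?q) (\<lambda>Ms. return_pmf (P, M1 \<union> M2 \<union> N \<union> \<Union>(set Ms))))))"
    by (subst bind_commute_pmf) (rule refl)
  also have "\<dots> = bind_pmf triple_pmf (\<lambda>(M1, M2, N).
      bind_pmf (replicate_pmf (d - 3) ?q) (\<lambda>Ms. return_pmf (P, M1 \<union> M2 \<union> N \<union> \<Union>(set Ms))))"
    unfolding triple_pmf_def pair_pmf_def by (simp add: bind_assoc_pmf bind_return_pmf)
  finally show ?thesis .
qed

lemma port_sets_finite_nonempty:
  assumes "finite L" "finite R" "L \<inter> R = {}" "p \<le> card L" "p \<le> card R"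
  shows "finite (port_sets L R p)" "port_sets L R p \<noteq> {}"
proof -
  show "finite (port_sets L R p)"
    unfolding port_sets_def using assms(1,2) by (auto intro: finite_subset[of _ "Pow (L \<union> R)"])
  obtain A where A: "A \<subseteq> L" "card A = p" using assms(4) by (meson obtain_subset_with_card_n)
  obtain B where B: "B \<subseteq> R" "card B = p" using assms(5) by (meson obtain_subset_with_card_n)
  have "(A \<union> B) \<inter> L = A" "(A \<union> B) \<inter> R = B" using A B assms(3) by auto
  then have "A \<union> B \<in> port_sets L R p" unfolding port_sets_def using A B by auto
  then show "port_sets L R p \<noteq> {}" by blast
qed

text \<open>The estimate is uniform in the port set, hence survives averaging over it. The event
  \<open>A\<close> stays abstract: all that matters is that its outcomes fail to expand.\<close>

lemma prob_random_port_graph_le: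
  assumes fin: "finite L" "finite R" and card: "card L = b" "card R = b" and disj: "L \<inter> R = {}"
    and d: "3 \<le> d"
    and \<epsilon>: "0 < \<epsilon>" "\<epsilon> \<le> 1 / 2" "64 * exp 8 * (2 * \<epsilon>) powr (1 / 16) \<le> 1 / 4"
    and \<theta>: "0 < \<theta>" "6 * \<theta> \<le> \<epsilon> / 4" "12 * \<theta> * (1 + ln (2 / (3 * \<theta>))) \<le> \<epsilon> / 32 * ln (3 / 2)"
    and b: "1 \<le> \<theta> * real b" and p: "real p \<le> real b powr (1 / 4)" "4 * real p \<le> \<theta> * real b"
    and A: "\<And>P E\<^sub>B. P \<in> port_sets L R p \<Longrightarrow> (P, E\<^sub>B) \<in> A \<Longrightarrow>
      finite E\<^sub>B \<and> \<not> port_expander (L \<union> R) E\<^sub>B P b (\<theta> / 2)"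
  shows "measure_pmf.prob (random_port_graph L R p (d - 1) 1) A
    \<le> real b powr (- 1 / 16) + (real b + 1) * exp (- (\<epsilon> / 32 * ln (3 / 2)) * real b)"
  unfolding random_port_graph_def
proof (rule prob_bind_pmf_le)
  fix P assume P: "P \<in> set_pmf (pmf_of_set (port_sets L R p))"
  have "\<theta> * real b \<le> 1 * real b" using \<theta>(2) \<epsilon>(2) by (intro mult_right_mono) auto
  then have "p \<le> b" using p(2) by linarith
  then have P: "P \<in> port_sets L R p"
    using P port_sets_finite_nonempty[OF fin disj, of p] card by simp
  interpret port_split L R P b p
    using P fin card disj unfolding port_sets_def by unfold_locales auto
  let ?B = "{(M1, M2, N). \<not> (\<forall>E. M1 \<union> M2 \<union> N \<subseteq> E \<longrightarrow> finite E \<longrightarrow>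
      port_expander (L \<union> R) E P b (\<theta> / 2))}"
  have "measure_pmf.prob (bind_pmf triple_pmf (\<lambda>(M1, M2, N).
      bind_pmf (replicate_pmf (d - 3) (pmf_of_set (perfect_matchings L R))) (\<lambda>Ms.
      return_pmf (P, M1 \<union> M2 \<union> N \<union> \<Union>(set Ms))))) A \<le> measure_pmf.prob triple_pmf ?B"
  proof (rule prob_bind_pmf_le_prob)
    fix x y assume y: "y \<in> set_pmf (case x of (M1, M2, N) \<Rightarrow>
      bind_pmf (replicate_pmf (d - 3) (pmf_of_set (perfect_matchings L R))) (\<lambda>Ms.
      return_pmf (P, M1 \<union> M2 \<union> N \<union> \<Union>(set Ms))))" "y \<in> A"
    obtain M1 M2 N where x: "x = (M1, M2, N)" by (cases x)
    obtain Ms where yP: "y = (P, M1 \<union> M2 \<union> N \<union> \<Union>(set Ms))" using y(1) unfolding x by auto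
    have "finite (M1 \<union> M2 \<union> N \<union> \<Union>(set Ms)) \<and>
        \<not> port_expander (L \<union> R) (M1 \<union> M2 \<union> N \<union> \<Union>(set Ms)) P b (\<theta> / 2)"
      using y(2) P unfolding yP by (intro A)
    then show "x \<in> ?B" unfolding x by blast
  qed
  also have "\<dots> \<le> real b powr (- 1 / 16) + (real b + 1) * exp (- (\<epsilon> / 32 * ln (3 / 2)) * real b)"
    using \<epsilon> \<theta> b p by (rule prob_port_expander)
  finally show "measure_pmf.prob (bind_pmf (replicate_pmf (d - 1) (pmf_of_set (perfect_matchings L R))) (\<lambda>Ms.
     bind_pmf (replicate_pmf 1 (pmf_of_set (perfect_matchings (L - P) (R - P)))) (\<lambda>Ns.
     return_pmf (P, \<Union>(set Ms) \<union> \<Union>(set Ns))))) A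
    \<le> real b powr (- 1 / 16) + (real b + 1) * exp (- (\<epsilon> / 32 * ln (3 / 2)) * real b)"
    unfolding random_matchings_eq_bind_triple[OF d] .
qed

section \<open>Choice of the constants and passage to the limit\<close>

lemma expansion_constants_exist:
  obtains \<epsilon> \<theta> :: real where "0 < \<epsilon>" "\<epsilon> \<le> 1 / 2" "64 * exp 8 * (2 * \<epsilon>) powr (1 / 16) \<le> 1 / 4"
    "0 < \<theta>" "6 * \<theta> \<le> \<epsilon> / 4" "12 * \<theta> * (1 + ln (2 / (3 * \<theta>))) \<le> \<epsilon> / 32 * ln (3 / 2)"
proof -
  \<comment> \<open>Chosen so that \<open>64 * exp 8 * a = 1 / 4\<close>, while
    \<open>2 * \<epsilon> = a ^ 16\<close>.\<close>
  define a where "a = (1 / (256 * exp 8) :: real)"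
  define \<epsilon> where "\<epsilon> = a ^ 16 / 2"
  have a: "0 < a" "a \<le> 1"
  proof -
    show "0 < a" unfolding a_def by simp
    have "1 \<le> exp (8 :: real)" by simp
    then have "1 \<le> 256 * exp (8 :: real)" by linarith
    then show "a \<le> 1" unfolding a_def by simp
  qed
  have \<epsilon>: "0 < \<epsilon>" "\<epsilon> \<le> 1 / 2" using a by (simp_all add: \<epsilon>_def power_le_one)
  have "(2 * \<epsilon>) powr (1 / 16) = (a powr 16) powr (1 / 16)" using a by (simp add: \<epsilon>_def)
  also have "\<dots> = a" using a unfolding powr_powr by simp
  finally have \<epsilon>3: "64 * exp 8 * (2 * \<epsilon>) powr (1 / 16) \<le> 1 / 4" by (simp add: a_def)
  \<comment> \<open>The entropy term vanishes with \<theta>, so \<theta> can be picked after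
    \<epsilon>.\<close>
  have "((\<lambda>\<theta>::real. 12 * \<theta> * (1 + ln (2 / (3 * \<theta>)))) \<longlongrightarrow> 0) (at_right 0)" by real_asymp
  moreover have "0 < \<epsilon> / 32 * ln (3 / 2 :: real)" using \<epsilon> by simp
  ultimately have ev1: "\<forall>\<^sub>F \<theta> in at_right 0. 12 * \<theta> * (1 + ln (2 / (3 * \<theta>))) < \<epsilon> / 32 * ln (3 / 2)"
    by (rule order_tendstoD)
  have ev2: "\<forall>\<^sub>F \<theta> in at_right 0. \<theta> \<in> {0<..<\<epsilon> / 24}" using \<epsilon> by (intro eventually_at_right_real) simp
  from ev1 ev2 have "\<forall>\<^sub>F \<theta> in at_right 0. 12 * \<theta> * (1 + ln (2 / (3 * \<theta>))) < \<epsilon> / 32 * ln (3 / 2)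
      \<and> \<theta> \<in> {0<..<\<epsilon> / 24}" by (rule eventually_conj)
  then obtain \<theta> where "12 * \<theta> * (1 + ln (2 / (3 * \<theta>))) < \<epsilon> / 32 * ln (3 / 2)" "\<theta> \<in> {0<..<\<epsilon> / 24}"
    using eventually_happens[of _ "at_right (0 :: real)"] by (auto simp: trivial_limit_at_right_real)
  then show ?thesis using that[of \<epsilon> \<theta>] \<epsilon> \<epsilon>3 by auto
qed

lemma powr_plus_exp_tendsto_0:
  assumes "0 < c"
  shows "(\<lambda>b :: nat. real b powr (- 1 / 16) + (real b + 1) * exp (- c * real b)) \<longlonglongrightarrow> 0"
  using assms by real_asymp

text \<open>The exponent \<open>2 * b\<close> is even, so without \<open>max 0\<close> a base below
  -1 would ask for a probability above 1. The field enters as \<open>\<bar>h\<bar>\<close> since for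
  negative \<open>h\<close> the colours other than \<kappa> are favoured: if there are at least two
  of them, a very negative \<open>h\<close> does not suppress mixtures of these, whereas
  \<open>exp (2 * h)\<close> would tend to 0.\<close>

theorem theorem5p3:
  fixes L R :: "nat \<Rightarrow> 'v set" and d :: "nat \<Rightarrow> nat" and \<alpha> :: real
  assumes "\<And>b. finite (L b)" and "\<And>b. finite (R b)"
    and "\<And>b. card (L b) = b" and "\<And>b. card (R b) = b"
    and "\<And>b. L b \<inter> R b = {}"
    and "\<And>b. 3 \<le> d b" and "(\<lambda>b. real (d b)) \<in> O(\<lambda>_. 1)"
    and "0 < \<alpha>" and "\<alpha> \<le> 1 / 4"
  shows "\<exists>\<delta>>0.
    (\<lambda>b. measure_pmf.prob
       (random_port_graph (L b) (R b) (nat \<lfloor>real b powr \<alpha>\<rfloor>) (d b - 1) 1)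
       {(P, E\<^sub>B). \<forall>V E q \<beta>\<^sub>B \<beta> h \<kappa>.
          port_extension (L b \<union> R b) E\<^sub>B P 1 V E \<longrightarrow>
          \<beta>\<^sub>B > 0 \<longrightarrow> (\<forall>e\<in>E\<^sub>B. \<beta> e = \<beta>\<^sub>B) \<longrightarrow> (\<forall>e\<in>E - E\<^sub>B. \<bar>\<beta> e\<bar> \<le> \<beta>\<^sub>B) \<longrightarrow>
          \<kappa> \<in> {1..q} \<longrightarrow>
          (\<forall>\<tau> \<in> configs (V - (L b \<union> R b)) q.
             \<P>(\<sigma> in potts_pmf V E \<beta> (\<lambda>v i. h * of_bool (i = \<kappa>) * of_bool (v \<in> L b \<union> R b)) q.
                 (\<exists>i\<in>{1..q}. \<forall>v\<in>L b \<union> R b. \<sigma> v = i)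
                 \<bar> \<forall>v\<in>V - (L b \<union> R b). \<sigma> v = \<tau> v)
             \<ge> (max 0 (1 - real q ^ 2 * exp (2 * \<bar>h\<bar>) / exp (\<delta> * \<beta>\<^sub>B * real (d b)))) ^ (2 * b))})
    \<longlonglongrightarrow> 1"
proof -
  obtain \<epsilon> \<theta> :: real where \<epsilon>: "0 < \<epsilon>" "\<epsilon> \<le> 1 / 2" "64 * exp 8 * (2 * \<epsilon>) powr (1 / 16) \<le> 1 / 4"
    and \<theta>: "0 < \<theta>" "6 * \<theta> \<le> \<epsilon> / 4" "12 * \<theta> * (1 + ln (2 / (3 * \<theta>))) \<le> \<epsilon> / 32 * ln (3 / 2)"
    by (rule expansion_constants_exist)
  obtain D where D: "0 < D" "\<forall>\<^sub>F b in sequentially. norm (real (d b)) \<le> D * norm (1 :: real)"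
    using assms(7) by (rule landau_o.bigE)
  \<comment> \<open>\<open>\<theta> / 2\<close> is the expansion constant, a quarter of it survives
    in \<open>port_expander_coloring\<close>, and \<open>D\<close> eventually bounds the
    degree.\<close>
  define \<delta> where "\<delta> = \<theta> / 8 / D"
  define p where "p b = nat \<lfloor>real b powr \<alpha>\<rfloor>" for b :: nat
  define bound where "bound = (\<lambda>b :: nat. real b powr (- 1 / 16) +
    (real b + 1) * exp (- (\<epsilon> / 32 * ln (3 / 2)) * real b))"
  define good where "good b = {(P, E\<^sub>B). \<forall>V E q \<beta>\<^sub>B \<beta> h \<kappa>.
          port_extension (L b \<union> R b) E\<^sub>B P 1 V E \<longrightarrow>
          \<beta>\<^sub>B > 0 \<longrightarrow> (\<forall>e\<in>E\<^sub>B. \<beta> e = \<beta>\<^sub>B) \<longrightarrow> (\<forall>e\<in>E - E\<^sub>B. \<bar>\<beta> e\<bar> \<le> \<beta>\<^sub>B) \<longrightarrow>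
          \<kappa> \<in> {1..q} \<longrightarrow>
          (\<forall>\<tau> \<in> configs (V - (L b \<union> R b)) q.
             \<P>(\<sigma> in potts_pmf V E \<beta> (\<lambda>v i. h * of_bool (i = \<kappa>) * of_bool (v \<in> L b \<union> R b)) q.
                 (\<exists>i\<in>{1..q}. \<forall>v\<in>L b \<union> R b. \<sigma> v = i)
                 \<bar> \<forall>v\<in>V - (L b \<union> R b). \<sigma> v = \<tau> v)
             \<ge> (max 0 (1 - real q ^ 2 * exp (2 * \<bar>h\<bar>) / exp (\<delta> * \<beta>\<^sub>B * real (d b)))) ^ (2 * b))}" for b
  have \<delta>: "0 < \<delta>" using \<theta> D by (simp add: \<delta>_def)
  have "\<forall>\<^sub>F b in sequentially. 1 \<le> \<theta> * real b" using \<theta>(1) by real_asymp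
  moreover have "\<forall>\<^sub>F b in sequentially. 4 * real b powr (1 / 4) \<le> \<theta> * real b" using \<theta>(1) by real_asymp
  ultimately have ev: "\<forall>\<^sub>F b in sequentially.
    1 - bound b \<le> measure_pmf.prob (random_port_graph (L b) (R b) (p b) (d b - 1) 1) (good b)"
    using D(2)
  proof eventually_elim
    case (elim b)
    have b0: "0 < b" using elim(1) by (cases b) auto
    have "real (p b) \<le> real b powr \<alpha>" unfolding p_def by simp
    also have "\<dots> \<le> real b powr (1 / 4)" using b0 assms(9) by (intro powr_mono) auto
    finally have p1: "real (p b) \<le> real b powr (1 / 4)" .
    then have p4: "4 * real (p b) \<le> \<theta> * real b" using elim(2) by linarith
    have "\<theta> / 8 / D * real (d b) \<le> \<theta> / 8 / D * D"
      using elim(3) \<theta> D by (intro mult_left_mono) auto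
    then have \<delta>d: "\<delta> * real (d b) \<le> \<theta> / 2 / 4" using D by (simp add: \<delta>_def)
    have "measure_pmf.prob (random_port_graph (L b) (R b) (p b) (d b - 1) 1) (- good b) \<le> bound b"
      unfolding bound_def
    proof (rule prob_random_port_graph_le[OF assms(1-6) \<epsilon> \<theta> elim(1) p1 p4])
      fix P E\<^sub>B assume P: "P \<in> port_sets (L b) (R b) (p b)" and bad: "(P, E\<^sub>B) \<in> - good b"
      interpret port_split "L b" "R b" P b "p b"
        using P assms(1-5) unfolding port_sets_def by unfold_locales auto
      have finW: "finite (L b \<union> R b)" using fin by simp
      from bad obtain V E q \<beta>\<^sub>B \<beta> h \<kappa> \<tau> where ext: "port_extension (L b \<union> R b) E\<^sub>B P 1 V E"
        and \<beta>: "\<beta>\<^sub>B > 0" "\<forall>e\<in>E\<^sub>B. \<beta> e = \<beta>\<^sub>B" "\<forall>e\<in>E - E\<^sub>B. \<bar>\<beta> e\<bar> \<le> \<beta>\<^sub>B"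
        and \<kappa>: "\<kappa> \<in> {1..q}" and \<tau>: "\<tau> \<in> configs (V - (L b \<union> R b)) q"
        and not_ge: "\<not> \<P>(\<sigma> in potts_pmf V E \<beta> (\<lambda>v i. h * of_bool (i = \<kappa>) * of_bool (v \<in> L b \<union> R b)) q.
                 (\<exists>i\<in>{1..q}. \<forall>v\<in>L b \<union> R b. \<sigma> v = i)
                 \<bar> \<forall>v\<in>V - (L b \<union> R b). \<sigma> v = \<tau> v)
             \<ge> (max 0 (1 - real q ^ 2 * exp (2 * \<bar>h\<bar>) / exp (\<delta> * \<beta>\<^sub>B * real (d b)))) ^ (2 * b)"
        unfolding good_def Compl_iff mem_Collect_eq prod.case by blast
      have "\<not> port_expander (L b \<union> R b) E\<^sub>B P b (\<theta> / 2)"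
      proof
        assume exp: "port_expander (L b \<union> R b) E\<^sub>B P b (\<theta> / 2)"
        show False
          using not_ge potts_monochromatic_cond_prob_ge[OF finW card_V b0 P_sub card_P_total exp _ _ ext \<beta>(1)
            bspec[OF \<beta>(2)] bspec[OF \<beta>(3)] \<kappa> \<tau> \<delta>d] \<theta>(1) p4 by simp
      qed
      then show "finite E\<^sub>B \<and> \<not> port_expander (L b \<union> R b) E\<^sub>B P b (\<theta> / 2)"
        using port_extension_finite_edges[OF ext] finite_subset by blast
    qed
    then show ?case
      using measure_pmf.prob_compl[of "good b" "random_port_graph (L b) (R b) (p b) (d b - 1) 1"]
      by (simp add: Compl_eq_Diff_UNIV)
  qed
  have "0 < \<epsilon> / 32 * ln (3 / 2 :: real)" using \<epsilon> by simp
  then have "bound \<longlonglongrightarrow> 0" unfolding bound_def by (rule powr_plus_exp_tendsto_0)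
  then have "(\<lambda>b. 1 - bound b) \<longlonglongrightarrow> 1 - 0" by (intro tendsto_diff tendsto_const)
  then have lim: "(\<lambda>b. 1 - bound b) \<longlonglongrightarrow> 1" by simp
  have "(\<lambda>b. measure_pmf.prob (random_port_graph (L b) (R b) (p b) (d b - 1) 1) (good b)) \<longlonglongrightarrow> 1"
    by (rule tendsto_sandwich[OF ev _ lim tendsto_const]) simp
  with \<delta> show ?thesis unfolding good_def p_def by (intro exI[of _ \<delta>] conjI)
qed

end
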